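(* Let $\lambda>0$ and $\beta\in(0,1]$. The $S_{\pi_{\lambda,\beta}}$-transform, $(S_{\pi_{\lambda,\beta}}\Phi)(z)=\langle\!\langle \mathrm{e}_{\pi_{\lambda,\beta}}(z;\cdot),\Phi\rangle\!\rangle_{\pi_{\lambda,\beta}}$ (for $z$ in a neighborhood of $0\in\mathbb{C}$ depending on $\Phi$), is a homeomorphism between the generalized function space $(N)^{-1}_{\pi_{\lambda,\beta}}$ and the space $\mathrm{Hol}_0(\mathbb{C})$ of holomorphic functions in a neighborhood of the origin.
   Context: $\mathbb{N}_0=\{0,1,2,\dots\}$. The Mittag-Leffler function is $E_\beta(z)=\sum_{n=0}^\infty \frac{z^n}{\Gamma(\beta n+1)}$. The fractional Poisson measure $\pi_{\lambda,\beta}$ is the probability measure on $\mathbb{R}$ concentrated on $\mathbb{N}_0$ with $\pi_{\lambda,\beta}(\{k\})=\frac{\lambda^k}{k!}E_\beta^{(k)}(-\lambda)$; its Laplace transform is $E_\beta(\lambda(e^z-1))$. The Wick exponential is $\mathrm{e}_{\pi_{\lambda,\beta}}(z;x)=\frac{e^{zx}}{E_\beta(\lambda(e^z-1))}$. The generalized Appell polynomials $C_n^{\lambda,\beta}$ are defined by $\mathrm{e}_{\pi_{\lambda,\beta}}(\log(1+z);x)=\sum_{n=0}^\infty\frac{z^n}{n!}C_n^{\lambda,\beta}(x)$ for $z$ near $0$; equivalently $\mathrm{e}_{\pi_{\lambda,\beta}}(z;\cdot)=\sum_{n=0}^\infty\frac{(e^z-1)^n}{n!}C_n^{\lambda,\beta}$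 for $z$ near $0$. For $q\in\mathbb{N}_0$, $(H)^1_{q,\pi_{\lambda,\beta}}$ is the Hilbert space of series $\varphi=\sum_n\varphi_nC_n^{\lambda,\beta}$ with $\|\varphi\|^2_{q,1,\pi_{\lambda,\beta}}=\sum_{n}(n!)^22^{nq}|\varphi_n|^2<\infty$. The generalized dual Appell system $(Q_n^{\pi_{\lambda,\beta}})_{n\in\mathbb{N}_0}$ consists of the functionals $Q_n^{\pi_{\lambda,\beta}}$ on polynomials given by $\langle\!\langle\varphi,Q_n^{\pi_{\lambda,\beta}}\rangle\!\rangle_{\pi_{\lambda,\beta}}=\int_{\mathbb{R}}(\Delta^n\varphi)(x)\,\mathrm{d}\pi_{\lambda,\beta}(x)$, $(\Delta\varphi)(x)=\varphi(x+1)-\varphi(x)$; they satisfy $\langle\!\langle C_n^{\lambda,\beta},Q_m^{\pi_{\lambda,\beta}}\rangle\!\rangle_{\pi_{\lambda,\beta}}=n!\delta_{n,m}$. The dual space of $(H)^1_{q,\pi_{\lambda,\beta}}$ is $(H)^{-1}_{-q,\pi_{\lambda,\beta}}$, the Hilbert space of series $\Phi=\sum_n\Phi_nQ_n^{\pi_{\lambda,\beta}}$, $\Phi_n\in\mathbb{C}$, with $\|\Phi\|^2_{-q,-1,\pi_{\lambda,\beta}}=\sum_n2^{-nq}|\Phi_n|^2<\infty$, and the pairing is $\langle\!\langle\varphi,\Phi\rangle\!\rangle_{\pi_{\lambda,\beta}}=\sum_n n!\,\varphi_n\Phi_n$. The generalized function space is $(N)^{-1}_{\pi_{\lambda,\beta}}=\bigcup_{q\in\mathbb{N}_0}(H)^{-1}_{-q,\pi_{\lambda,\beta}}$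 with the inductive limit topology. If $\Phi\in(H)^{-1}_{-q,\pi_{\lambda,\beta}}$, then $\mathrm{e}_{\pi_{\lambda,\beta}}(z;\cdot)\in(H)^1_{q,\pi_{\lambda,\beta}}$ for all $z$ sufficiently close to $0$, so $(S_{\pi_{\lambda,\beta}}\Phi)(z)$ is defined for such $z$. In $\mathrm{Hol}_0(\mathbb{C})$ functions agreeing in a neighborhood of $0$ are identified. It is the union over $l\in\mathbb{N}_0$ of the sets of $U$ with $|U|_{l,\infty}=\sup_{|z|\le2^{-l}}|U(z)|<\infty$, equivalently the union over $q\in\mathbb{N}_0$ of the Hilbert spaces of $U(z)=\sum_nU_nz^n$ with $\sum_n2^{-nq}|U_n|^2<\infty$, and it carries the corresponding inductive limit topology. *)

theory Defs
  imports "HOL-Complex_Analysis.Complex_Analysis" "HOL-Probability.Probability"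
    "HOL-Library.Function_Algebras"
begin

section \<open>Locally convex inductive limits\<close>

text \<open>Generalized functions are functionals on polynomials, added and scaled pointwise.\<close>

instantiation "fun" :: (type, real_vector) real_vector
begin

definition scaleR_fun :: "real \<Rightarrow> ('a \<Rightarrow> 'b) \<Rightarrow> 'a \<Rightarrow> 'b"
  where "scaleR_fun r f = (\<lambda>x. r *\<^sub>R f x)"

instance
  by standard (auto simp: scaleR_fun_def plus_fun_def scaleR_add_right scaleR_add_left)

end

text \<open>
  The finest locally convex topology on the union of the increasing normed spaces \<open>(E q, N q)\<close>
  for which all inclusions are continuous: a set is open if it is a neighbourhood of each of its
  points, where the neighbourhoods of \<open>0\<close> are generated by the convex sets whose trace on every
  \<open>E q\<close> contains a ball around \<open>0\<close>. For complex spaces \<open>E q\<close> it makes no difference whether real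
  or complex scalars are used here: multiplication by a complex number of modulus one is
  isometric on every \<open>E q\<close>, so absolutely convex sets would give the same topology.
\<close>

definition ind_lim_open :: "(nat \<Rightarrow> 'a::real_vector set) \<Rightarrow> (nat \<Rightarrow> 'a \<Rightarrow> real) \<Rightarrow> 'a set \<Rightarrow> bool" where
  "ind_lim_open E N U \<longleftrightarrow> U \<subseteq> (\<Union>q. E q) \<and>
     (\<forall>x\<in>U. \<exists>V. convex V \<and> (\<forall>q. \<exists>\<epsilon>>0. {v \<in> E q. N q v < \<epsilon>} \<subseteq> V) \<and> (\<lambda>v. x + v) ` V \<subseteq> U)"

definition ind_lim_topology :: "(nat \<Rightarrow> 'a::real_vector set) \<Rightarrow> (nat \<Rightarrow> 'a \<Rightarrow> real) \<Rightarrow> 'a topology" where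
  "ind_lim_topology E N = topology (ind_lim_open E N)"

lemma istopology_ind_lim_open: "istopology (ind_lim_open E N)"
  unfolding istopology_def
proof (intro conjI allI impI)
  fix S T assume S: "ind_lim_open E N S" and T: "ind_lim_open E N T"
  show "ind_lim_open E N (S \<inter> T)"
    unfolding ind_lim_open_def
  proof (intro conjI ballI)
    show "S \<inter> T \<subseteq> (\<Union>q. E q)" using S by (auto simp: ind_lim_open_def)
    fix x assume x: "x \<in> S \<inter> T"
    obtain V where V: "convex V" "\<forall>q. \<exists>\<epsilon>>0. {v \<in> E q. N q v < \<epsilon>} \<subseteq> V" "(\<lambda>v. x + v) ` V \<subseteq> S"
      using S x unfolding ind_lim_open_def by blast
    obtain W where W: "convex W" "\<forall>q. \<exists>\<epsilon>>0. {v \<in> E q. N q v < \<epsilon>} \<subseteq> W" "(\<lambda>v. x + v) ` W \<subseteq> T"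
      using T x unfolding ind_lim_open_def by blast
    have "\<exists>\<epsilon>>0. {v \<in> E q. N q v < \<epsilon>} \<subseteq> V \<inter> W" for q
    proof -
      obtain a b where ab: "a > 0" "{v \<in> E q. N q v < a} \<subseteq> V" "b > 0" "{v \<in> E q. N q v < b} \<subseteq> W"
        using V(2) W(2) by meson
      then have "{v \<in> E q. N q v < min a b} \<subseteq> V \<inter> W" by auto
      with ab show ?thesis by (intro exI[of _ "min a b"]) auto
    qed
    moreover have "convex (V \<inter> W)" using V(1) W(1) by (rule convex_Int)
    moreover have "(\<lambda>v. x + v) ` (V \<inter> W) \<subseteq> S \<inter> T" using V(3) W(3) by blast
    ultimately show "\<exists>V. convex V \<and> (\<forall>q. \<exists>\<epsilon>>0. {v \<in> E q. N q v < \<epsilon>} \<subseteq> V) \<and> (\<lambda>v. x + v) ` V \<subseteq> S \<inter> T"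
      by blast
  qed
next
  fix \<K> assume K: "\<forall>K\<in>\<K>. ind_lim_open E N K"
  show "ind_lim_open E N (\<Union>\<K>)"
    unfolding ind_lim_open_def
  proof (intro conjI ballI)
    show "\<Union>\<K> \<subseteq> (\<Union>q. E q)"
      using K unfolding ind_lim_open_def by (intro Union_least) (drule (1) bspec, erule conjunct1)
    fix x assume "x \<in> \<Union>\<K>"
    then obtain A where A: "A \<in> \<K>" "x \<in> A" by blast
    then have "ind_lim_open E N A" using K by blast
    then obtain V where "convex V" "\<forall>q. \<exists>\<epsilon>>0. {v \<in> E q. N q v < \<epsilon>} \<subseteq> V" "(\<lambda>v. x + v) ` V \<subseteq> A"
      using A(2) unfolding ind_lim_open_def by blast
    moreover from this(3) A(1) have "(\<lambda>v. x + v) ` V \<subseteq> \<Union>\<K>" by blast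
    ultimately show "\<exists>V. convex V \<and> (\<forall>q. \<exists>\<epsilon>>0. {v \<in> E q. N q v < \<epsilon>} \<subseteq> V) \<and> (\<lambda>v. x + v) ` V \<subseteq> \<Union>\<K>"
      by blast
  qed
qed

lemma openin_ind_lim_topology: "openin (ind_lim_topology E N) = ind_lim_open E N"
  unfolding ind_lim_topology_def by (rule topology_inverse'[OF istopology_ind_lim_open])


section \<open>The fractional Poisson measure and its Appell polynomials\<close>

definition mittag_leffler :: "real \<Rightarrow> complex \<Rightarrow> complex" where
  "mittag_leffler \<beta> z = (\<Sum>n. z ^ n / Gamma (of_real (\<beta> * real n + 1)))"

text \<open>
  All derivatives of the Mittag-Leffler function are real on the real axis. For \<open>lam > 0\<close> and
  \<open>0 < \<beta> \<le> 1\<close> these weights are nonnegative (\<open>\<lambda>x. mittag_leffler \<beta> (- x)\<close> is completely monotone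
  on the positive axis), so that \<open>ennreal\<close> truncates nothing below.
\<close>

definition fractional_poisson_weight :: "real \<Rightarrow> real \<Rightarrow> nat \<Rightarrow> real" where
  "fractional_poisson_weight lam \<beta> k =
     lam ^ k / fact k * Re ((deriv ^^ k) (mittag_leffler \<beta>) (- of_real lam))"

definition fractional_poisson :: "real \<Rightarrow> real \<Rightarrow> real measure" where
  "fractional_poisson lam \<beta> =
     distr (density (count_space (UNIV :: nat set)) (\<lambda>k. ennreal (fractional_poisson_weight lam \<beta> k)))
       borel real"

definition wick_exp :: "real \<Rightarrow> real \<Rightarrow> complex \<Rightarrow> real \<Rightarrow> complex" where
  "wick_exp lam \<beta> z x = exp (z * of_real x) / mittag_leffler \<beta> (of_real lam * (exp z - 1))"

definition appell :: "real \<Rightarrow> real \<Rightarrow> nat \<Rightarrow> real \<Rightarrow> complex" where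
  "appell lam \<beta> = (THE C. \<forall>x. \<forall>\<^sub>F z in nhds 0.
     (\<lambda>n. z ^ n / fact n * C n x) sums wick_exp lam \<beta> (Ln (1 + z)) x)"


section \<open>Test functions, generalized functions and their pairing\<close>

text \<open>Coefficient sequences of the elements of the Hilbert space of test functions of order \<open>q\<close>.\<close>

definition test_coeffs :: "nat \<Rightarrow> (nat \<Rightarrow> complex) set" where
  "test_coeffs q = {a. summable (\<lambda>n. (fact n)\<^sup>2 * 2 ^ (n * q) * (cmod (a n))\<^sup>2)}"

text \<open>
  The coefficients of a function \<open>\<phi>\<close> that is (pointwise) the sum of an Appell series belonging to
  the space of order \<open>q\<close>. For large \<open>q\<close>, depending on \<open>lam\<close> and \<open>\<beta>\<close>, every series in that
  space converges pointwise and the coefficients are determined by the sum.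
\<close>

definition appell_coeff :: "real \<Rightarrow> real \<Rightarrow> nat \<Rightarrow> (real \<Rightarrow> complex) \<Rightarrow> nat \<Rightarrow> complex" where
  "appell_coeff lam \<beta> q \<phi> =
     (THE a. a \<in> test_coeffs q \<and> (\<forall>x. (\<lambda>n. a n * appell lam \<beta> n x) sums \<phi> x))"

definition fdiff :: "complex poly \<Rightarrow> complex poly" where
  "fdiff p = pcompose p [:1, 1:] - p"

definition dual_appell :: "real \<Rightarrow> real \<Rightarrow> nat \<Rightarrow> complex poly \<Rightarrow> complex" where
  "dual_appell lam \<beta> n p =
     (LINT x|fractional_poisson lam \<beta>. poly ((fdiff ^^ n) p) (of_real x))"

text \<open>
  A series of dual Appell functionals, evaluated on polynomials. On a polynomial of degree \<open>d\<close> only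
  the terms with \<open>n \<le> d\<close> are nonzero, so every coefficient sequence gives a functional.
\<close>

definition dual_series :: "real \<Rightarrow> real \<Rightarrow> (nat \<Rightarrow> complex) \<Rightarrow> complex poly \<Rightarrow> complex" where
  "dual_series lam \<beta> c = (\<lambda>p. \<Sum>n. c n * dual_appell lam \<beta> n p)"

definition dual_coeff :: "real \<Rightarrow> real \<Rightarrow> (complex poly \<Rightarrow> complex) \<Rightarrow> nat \<Rightarrow> complex" where
  "dual_coeff lam \<beta> \<Phi> = (THE c. dual_series lam \<beta> c = \<Phi>)"

definition gen_space :: "real \<Rightarrow> real \<Rightarrow> nat \<Rightarrow> (complex poly \<Rightarrow> complex) set" where
  "gen_space lam \<beta> q =
     {dual_series lam \<beta> c | c. summable (\<lambda>n. (cmod (c n))\<^sup>2 / 2 ^ (n * q))}"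

definition gen_norm :: "real \<Rightarrow> real \<Rightarrow> nat \<Rightarrow> (complex poly \<Rightarrow> complex) \<Rightarrow> real" where
  "gen_norm lam \<beta> q \<Phi> = sqrt (\<Sum>n. (cmod (dual_coeff lam \<beta> \<Phi> n))\<^sup>2 / 2 ^ (n * q))"

definition gen_topology :: "real \<Rightarrow> real \<Rightarrow> (complex poly \<Rightarrow> complex) topology" where
  "gen_topology lam \<beta> = ind_lim_topology (gen_space lam \<beta>) (gen_norm lam \<beta>)"

definition pairing :: "real \<Rightarrow> real \<Rightarrow> nat \<Rightarrow> (real \<Rightarrow> complex) \<Rightarrow> (complex poly \<Rightarrow> complex) \<Rightarrow> complex" where
  "pairing lam \<beta> q \<phi> \<Phi> = (\<Sum>n. fact n * appell_coeff lam \<beta> q \<phi> n * dual_coeff lam \<beta> \<Phi> n)"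


section \<open>Germs of holomorphic functions at the origin\<close>

quotient_type hol0 = "complex \<Rightarrow> complex" / partial:
  "\<lambda>f g. f analytic_on {0} \<and> g analytic_on {0} \<and> (\<forall>\<^sub>F z in nhds 0. f z = g z)"
proof (rule part_equivpI)
  show "\<exists>f::complex \<Rightarrow> complex. f analytic_on {0} \<and> f analytic_on {0} \<and> (\<forall>\<^sub>F z in nhds 0. f z = f z)"
    by (rule exI[of _ "\<lambda>_. 0"]) auto
qed (auto intro!: sympI transpI simp: eq_commute elim: eventually_elim2)

abbreviation germ :: "(complex \<Rightarrow> complex) \<Rightarrow> hol0" where
  "germ \<equiv> abs_hol0"

instantiation hol0 :: real_vector
begin

lift_definition zero_hol0 :: hol0 is "\<lambda>_. 0" by auto

lift_definition plus_hol0 :: "hol0 \<Rightarrow> hol0 \<Rightarrow> hol0" is "\<lambda>f g z. f z + g z"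
  by (auto intro!: analytic_intros elim: eventually_elim2)

lift_definition minus_hol0 :: "hol0 \<Rightarrow> hol0 \<Rightarrow> hol0" is "\<lambda>f g z. f z - g z"
  by (auto intro!: analytic_intros elim: eventually_elim2)

lift_definition uminus_hol0 :: "hol0 \<Rightarrow> hol0" is "\<lambda>f z. - f z"
  by (auto intro!: analytic_intros elim: eventually_mono)

lift_definition scaleR_hol0 :: "real \<Rightarrow> hol0 \<Rightarrow> hol0" is "\<lambda>r f z. of_real r * f z"
  by (auto intro!: analytic_intros elim: eventually_mono)

instance
  by standard
    (transfer; auto intro!: analytic_intros always_eventually simp: algebra_simps elim: eventually_mono)+

end

text \<open>
  The germs represented by a function on the closed disc of radius \<open>2\<^sup>-\<^sup>l\<close> that is holomorphic
  inside and continuous up to the boundary, with the supremum norm on the closed disc. By the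
  identity theorem the germ determines its representative there.
\<close>

definition disc_rep :: "nat \<Rightarrow> hol0 \<Rightarrow> (complex \<Rightarrow> complex) \<Rightarrow> bool" where
  "disc_rep l u U \<longleftrightarrow> U holomorphic_on ball 0 (1 / 2 ^ l) \<and>
     continuous_on (cball 0 (1 / 2 ^ l)) U \<and> u = germ U"

definition hol0_space :: "nat \<Rightarrow> hol0 set" where
  "hol0_space l = {u. \<exists>U. disc_rep l u U}"

definition hol0_norm :: "nat \<Rightarrow> hol0 \<Rightarrow> real" where
  "hol0_norm l u =
     (THE s. \<exists>U. disc_rep l u U \<and> s = (SUP z\<in>cball 0 (1 / 2 ^ l). cmod (U z)))"

definition hol0_topology :: "hol0 topology" where
  "hol0_topology = ind_lim_topology hol0_space hol0_norm"


section \<open>The S-transform\<close>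

text \<open>
  A generalized function of order \<open>q\<close> also has every larger order, and the pairing is given by the
  same series at each order for which it is defined; only the neighbourhood of \<open>0\<close> on which the
  Wick exponential is a test function of order \<open>q\<close> shrinks. The germ is therefore the same for
  all large \<open>q\<close>. Small \<open>q\<close> are left out because of the pointwise convergence of Appell series.
\<close>

definition S_transform :: "real \<Rightarrow> real \<Rightarrow> (complex poly \<Rightarrow> complex) \<Rightarrow> hol0" where
  "S_transform lam \<beta> \<Phi> = (THE u. \<forall>\<^sub>F q in sequentially.
     u = germ (\<lambda>z. pairing lam \<beta> q (wick_exp lam \<beta> z) \<Phi>))"

end

theory Submission
  imports Defs
begin

text \<open>
  The \<open>n\<close>-th Appell coefficient of the Wick exponential at \<open>z\<close> is \<open>(exp z - 1) ^ n / n!\<close>, so the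
  S-transform of the generalized function with coefficients \<open>c\<close> is the germ of
  \<open>\<Sum>n. c n * (exp z - 1) ^ n\<close>: an ordinary power series in the local coordinate \<open>w = exp z - 1\<close>.
  Evaluating it on a small disc bounds the supremum norm by a weighted \<open>\<ell>\<^sup>2\<close> norm of \<open>c\<close>; conversely,
  Cauchy's inequality for \<open>U (Ln (1 + w))\<close> bounds a weighted \<open>\<ell>\<^sup>2\<close> norm of \<open>c\<close> by a supremum norm.
  A linear bijection with such bounds in both directions is a homeomorphism of the inductive limits.
\<close>

section \<open>Linear maps between inductive limits\<close>

text \<open>The objects in the statement are selected by \<open>THE\<close>, and much of the work is
  to show that each choice is determined. The main obstacle is \<open>appell_coeff\<close>: two
  Appell series with the same pointwise sum must have equal coefficients, and pointwise convergence
  alone does not let the dual functionals act term by term. The difference relation of the Appell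
  polynomials replaces them, combined with a smallness argument valid for large \<open>q\<close>;
  these are the only orders that \<open>S_transform\<close> looks at. For \<open>dual_coeff\<close>
  the point is that the total mass is nonzero, and for \<open>hol0_norm\<close> it is the identity
  theorem. The estimates in the two directions change the index (\<open>q\<close> to
  \<open>l\<close>, and \<open>l\<close> to \<open>2 * m + 1\<close>), which an inductive limit
  tolerates.\<close>

lemma subspace_Union_incseq:
  fixes E :: "nat \<Rightarrow> 'a::real_vector set"
  assumes "\<And>q. subspace (E q)" "incseq E"
  shows "subspace (\<Union>q. E q)"
  unfolding subspace_def
proof (intro conjI ballI allI)
  show "0 \<in> (\<Union>q. E q)" using assms(1) by (auto simp: subspace_0)
  fix x assume "x \<in> (\<Union>q. E q)"
  then obtain p where p: "x \<in> E p" by blast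
  show "c *\<^sub>R x \<in> (\<Union>q. E q)" for c using p assms(1) by (auto intro: subspace_scale)
  fix y assume "y \<in> (\<Union>q. E q)"
  then obtain q where "y \<in> E q" by blast
  then have "x \<in> E (max p q)" "y \<in> E (max p q)"
    using p incseqD[OF assms(2), of p "max p q"] incseqD[OF assms(2), of q "max p q"] by auto
  then show "x + y \<in> (\<Union>q. E q)" using assms(1) by (auto intro: subspace_add)
qed

text \<open>The union is itself an admissible convex neighbourhood of 0, and translation by one of
  its points maps it into itself; hence it is open.\<close>

lemma topspace_ind_lim_topology:
  fixes E :: "nat \<Rightarrow> 'a::real_vector set"
  assumes "subspace (\<Union>q. E q)"
  shows "topspace (ind_lim_topology E N) = (\<Union>q. E q)"
proof (rule antisym)
  show "topspace (ind_lim_topology E N) \<subseteq> (\<Union>q. E q)"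
    unfolding topspace_def openin_ind_lim_topology ind_lim_open_def by blast
  have "ind_lim_open E N (\<Union>q. E q)"
    unfolding ind_lim_open_def
  proof (intro conjI ballI exI[of _ "\<Union>q. E q"] allI)
    fix x q assume "x \<in> (\<Union>q. E q)"
    then show "(+) x ` (\<Union>q. E q) \<subseteq> (\<Union>q. E q)" using subspace_add[OF assms] by blast
    show "\<exists>\<epsilon>>0. {v \<in> E q. N q v < \<epsilon>} \<subseteq> (\<Union>q. E q)" by (intro exI[of _ 1]) auto
  qed (use assms subspace_imp_convex in auto)
  then show "(\<Union>q. E q) \<subseteq> topspace (ind_lim_topology E N)"
    by (simp add: openin_ind_lim_topology openin_subset)
qed

text \<open>Preimages of convex sets under a linear map are convex, and the estimate on
  \<open>E q\<close> puts a ball of radius \<open>\<epsilon> / K\<close> inside the preimage of an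
  \<open>\<epsilon>\<close>-ball.\<close>

lemma continuous_map_ind_lim_topology:
  fixes E :: "nat \<Rightarrow> 'a::real_vector set" and F :: "nat \<Rightarrow> 'b::real_vector set"
  assumes E: "subspace (\<Union>q. E q)" and F: "subspace (\<Union>q. F q)"
    and add: "\<And>x y. \<lbrakk>x \<in> (\<Union>q. E q); y \<in> (\<Union>q. E q)\<rbrakk> \<Longrightarrow> T (x + y) = T x + T y"
    and scale: "\<And>x r. x \<in> (\<Union>q. E q) \<Longrightarrow> T (r *\<^sub>R x) = r *\<^sub>R T x"
    and bounded: "\<And>q. \<exists>p K. K > 0 \<and> (\<forall>x\<in>E q. T x \<in> F p \<and> M p (T x) \<le> K * N q x)"
  shows "continuous_map (ind_lim_topology E N) (ind_lim_topology F M) T"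
  unfolding continuous_map_def topspace_ind_lim_topology[OF E] topspace_ind_lim_topology[OF F]
    openin_ind_lim_topology
proof (intro conjI allI impI)
  show "T \<in> (\<Union>q. E q) \<rightarrow> (\<Union>q. F q)"
  proof
    fix x assume "x \<in> (\<Union>q. E q)"
    then obtain q where "x \<in> E q" by blast
    then show "T x \<in> (\<Union>q. F q)" using bounded[of q] by blast
  qed
  fix U assume U: "ind_lim_open F M U"
  show "ind_lim_open E N {x \<in> (\<Union>q. E q). T x \<in> U}"
    unfolding ind_lim_open_def
  proof (intro conjI ballI)
    show "{x \<in> (\<Union>q. E q). T x \<in> U} \<subseteq> (\<Union>q. E q)" by blast
    fix x assume "x \<in> {x \<in> (\<Union>q. E q). T x \<in> U}"
    then have x: "x \<in> (\<Union>q. E q)" "T x \<in> U" by auto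
    then obtain V where V: "convex V" "\<And>p. \<exists>\<epsilon>>0. {v \<in> F p. M p v < \<epsilon>} \<subseteq> V" "(+) (T x) ` V \<subseteq> U"
      using U unfolding ind_lim_open_def by blast
    define W where "W = {v \<in> (\<Union>q. E q). T v \<in> V}"
    have "convex W"
      unfolding convex_def
    proof (intro ballI allI impI)
      fix v w and a b :: real
      assume vw: "v \<in> W" "w \<in> W" and ab: "0 \<le> a" "0 \<le> b" "a + b = 1"
      have mem: "v \<in> (\<Union>q. E q)" "w \<in> (\<Union>q. E q)" and TV: "T v \<in> V" "T w \<in> V"
        using vw unfolding W_def by blast+
      have mem': "a *\<^sub>R v \<in> (\<Union>q. E q)" "b *\<^sub>R w \<in> (\<Union>q. E q)"
        using mem E by (blast intro: subspace_scale)+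
      have "T (a *\<^sub>R v + b *\<^sub>R w) = a *\<^sub>R T v + b *\<^sub>R T w"
        using add[OF mem'] scale mem by simp
      also have "\<dots> \<in> V" using V(1) TV ab by (auto intro: convexD)
      finally have "T (a *\<^sub>R v + b *\<^sub>R w) \<in> V" .
      then show "a *\<^sub>R v + b *\<^sub>R w \<in> W"
        unfolding W_def using subspace_add[OF E mem'] by blast
    qed
    moreover have "\<forall>q. \<exists>\<epsilon>>0. {v \<in> E q. N q v < \<epsilon>} \<subseteq> W"
    proof
      fix q
      obtain p K where K: "K > 0" "\<And>v. v \<in> E q \<Longrightarrow> T v \<in> F p" "\<And>v. v \<in> E q \<Longrightarrow> M p (T v) \<le> K * N q v"
        using bounded[of q] by blast
      obtain \<epsilon> where \<epsilon>: "\<epsilon> > 0" "{v \<in> F p. M p v < \<epsilon>} \<subseteq> V" using V(2) by blast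
      have "v \<in> W" if v: "v \<in> E q" "N q v < \<epsilon> / K" for v
      proof -
        have "K * N q v < \<epsilon>" using v(2) K(1) by (simp add: field_simps)
        then have "M p (T v) < \<epsilon>" using K(3)[OF v(1)] by linarith
        then show ?thesis unfolding W_def using \<epsilon>(2) K(2) v(1) by blast
      qed
      then show "\<exists>\<epsilon>>0. {v \<in> E q. N q v < \<epsilon>} \<subseteq> W"
        using \<epsilon>(1) K(1) by (intro exI[of _ "\<epsilon> / K"]) auto
    qed
    moreover have "(+) x ` W \<subseteq> {x \<in> (\<Union>q. E q). T x \<in> U}"
    proof (rule image_subsetI)
      fix v assume "v \<in> W"
      then have v: "v \<in> (\<Union>q. E q)" "T v \<in> V" unfolding W_def by blast+
      have "T (x + v) = T x + T v" using add[OF x(1) v(1)] .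
      also have "\<dots> \<in> U" using V(3) v(2) by blast
      finally show "x + v \<in> {x \<in> (\<Union>q. E q). T x \<in> U}"
        using subspace_add[OF E x(1) v(1)] by blast
    qed
    ultimately show "\<exists>V. convex V \<and> (\<forall>q. \<exists>\<epsilon>>0. {v \<in> E q. N q v < \<epsilon>} \<subseteq> V) \<and>
        (+) x ` V \<subseteq> {x \<in> (\<Union>q. E q). T x \<in> U}" by blast
  qed
qed

text \<open>\<open>inverse_bounded\<close> asks for some preimage of controlled size; injectivity
  identifies it with the value of the inverse, so the continuity criterion applies to
  \<open>R\<close> as well.\<close>

lemma homeomorphic_map_ind_lim_topology:
  fixes E :: "nat \<Rightarrow> 'a::real_vector set" and F :: "nat \<Rightarrow> 'b::real_vector set"
  assumes E: "subspace (\<Union>q. E q)" and F: "subspace (\<Union>q. F q)"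
    and add: "\<And>x y. \<lbrakk>x \<in> (\<Union>q. E q); y \<in> (\<Union>q. E q)\<rbrakk> \<Longrightarrow> T (x + y) = T x + T y"
    and scale: "\<And>x r. x \<in> (\<Union>q. E q) \<Longrightarrow> T (r *\<^sub>R x) = r *\<^sub>R T x"
    and inj: "inj_on T (\<Union>q. E q)"
    and bounded: "\<And>q. \<exists>p K. K > 0 \<and> (\<forall>x\<in>E q. T x \<in> F p \<and> M p (T x) \<le> K * N q x)"
    and inverse_bounded: "\<And>p. \<exists>q K. K > 0 \<and> (\<forall>y\<in>F p. \<exists>x\<in>E q. T x = y \<and> N q x \<le> K * M p y)"
  shows "homeomorphic_map (ind_lim_topology E N) (ind_lim_topology F M) T"
proof -
  define R where "R = inv_into (\<Union>q. E q) T"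
  have R: "R (T x) = x" if "x \<in> (\<Union>q. E q)" for x
    unfolding R_def using inj that by (rule inv_into_f_f)
  have surj: "\<exists>x\<in>(\<Union>q. E q). T x = y" if y: "y \<in> (\<Union>p. F p)" for y
  proof -
    obtain p where p: "y \<in> F p" using y by blast
    obtain q K where "\<forall>y\<in>F p. \<exists>x\<in>E q. T x = y \<and> N q x \<le> K * M p y" using inverse_bounded[of p] by blast
    then obtain x where "x \<in> E q" "T x = y" using p by blast
    then show ?thesis by (intro bexI[of _ x] UN_I) auto
  qed
  have "continuous_map (ind_lim_topology F M) (ind_lim_topology E N) R"
  proof (rule continuous_map_ind_lim_topology[OF F E])
    fix y z assume yz: "y \<in> (\<Union>p. F p)" "z \<in> (\<Union>p. F p)"
    obtain u where u: "u \<in> (\<Union>q. E q)" "T u = y" using surj[OF yz(1)] ..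
    obtain v where v: "v \<in> (\<Union>q. E q)" "T v = z" using surj[OF yz(2)] ..
    have "R (T (u + v)) = u + v" by (rule R[OF subspace_add[OF E u(1) v(1)]])
    then show "R (y + z) = R y + R z"
      unfolding add[OF u(1) v(1)] u(2) v(2) using R[OF u(1)] R[OF v(1)] u(2) v(2) by simp
  next
    fix y r assume y: "y \<in> (\<Union>p. F p)"
    obtain u where u: "u \<in> (\<Union>q. E q)" "T u = y" using surj[OF y] ..
    have "R (T (r *\<^sub>R u)) = r *\<^sub>R u" by (rule R[OF subspace_scale[OF E u(1)]])
    then show "R (r *\<^sub>R y) = r *\<^sub>R R y"
      unfolding scale[OF u(1)] u(2) using R[OF u(1)] u(2) by simp
  next
    fix p
    obtain q K where K: "K > 0 \<and> (\<forall>y\<in>F p. \<exists>x\<in>E q. T x = y \<and> N q x \<le> K * M p y)"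
      using inverse_bounded[of p] by (elim exE)
    have "R y \<in> E q \<and> N q (R y) \<le> K * M p y" if y: "y \<in> F p" for y
    proof -
      obtain x where x: "x \<in> E q" "T x = y" "N q x \<le> K * M p y" using K y by blast
      have "x \<in> (\<Union>q. E q)" using x(1) by blast
      then have "R y = x" using R x(2) by blast
      with x show ?thesis by simp
    qed
    then show "\<exists>q K. K > 0 \<and> (\<forall>y\<in>F p. R y \<in> E q \<and> N q (R y) \<le> K * M p y)"
      using K by (intro exI[of _ q] exI[of _ K]) simp
  qed
  moreover have "continuous_map (ind_lim_topology E N) (ind_lim_topology F M) T"
    using E F add scale bounded by (rule continuous_map_ind_lim_topology)
  moreover have "T (R y) = y" if y: "y \<in> (\<Union>p. F p)" for y
  proof -
    obtain x where x: "x \<in> (\<Union>q. E q)" "T x = y" using surj[OF y] ..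
    then show ?thesis using R[OF x(1)] by simp
  qed
  ultimately have "homeomorphic_maps (ind_lim_topology E N) (ind_lim_topology F M) T R"
    unfolding homeomorphic_maps_def topspace_ind_lim_topology[OF E] topspace_ind_lim_topology[OF F]
    using R by simp
  then show ?thesis using homeomorphic_map_maps by blast
qed

section \<open>Mittag-Leffler function and total mass of the fractional Poisson measure\<close>

text \<open>Restricting Euler's integral to \<open>[M, M + 1]\<close>.\<close>

lemma Gamma_ge_powr:
  fixes x M :: real
  assumes "x > 0" "M > 0"
  shows "M powr x * exp (- M - 1) \<le> Gamma (x + 1)"
proof -
  have I: "((\<lambda>t. t powr x / exp t) has_integral Gamma (x + 1)) {0..}"
    using Gamma_integral_real[of "x + 1"] assms by simp
  have c: "((\<lambda>t. M powr x * exp (- M - 1)) has_integral (M powr x * exp (- M - 1))) {M..M+1}"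
    using has_integral_const_real[of "M powr x * exp (- M - 1)" M "M + 1"] by simp
  have "M powr x * exp (- M - 1) \<le> t powr x / exp t" if t: "t \<in> {M..M+1}" for t
  proof -
    have "M powr x \<le> t powr x" using assms t by (intro powr_mono2) auto
    moreover have "exp (- M - 1) \<le> exp (- t)" using t by simp
    ultimately have "M powr x * exp (- M - 1) \<le> t powr x * exp (- t)" by (intro mult_mono) auto
    then show ?thesis by (simp add: exp_minus field_simps)
  qed
  moreover have "(\<lambda>t. t powr x / exp t) integrable_on {M..M+1}"
    using I assms by (intro integrable_on_subinterval[of _ "{0..}"]) auto
  ultimately have "M powr x * exp (- M - 1) \<le> integral {M..M+1} (\<lambda>t. t powr x / exp t)"
    using c by (intro has_integral_le[OF c integrable_integral]) auto
  also have "\<dots> \<le> integral {0..} (\<lambda>t. t powr x / exp t)"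
    using I assms \<open>_ integrable_on {M..M+1}\<close> by (intro integral_subset_le) auto
  also have "\<dots> = Gamma (x + 1)" using I by (rule integral_unique)
  finally show ?thesis .
qed

lemma summable_mittag_leffler:
  fixes z :: complex
  assumes "\<beta> > 0"
  shows "summable (\<lambda>n. norm (z ^ n / Gamma (of_real (\<beta> * real n + 1))))"
proof -
  \<comment> \<open>Chosen so that \<open>M powr \<beta> = 2 * (norm z + 1)\<close>: the bound on
    \<open>Gamma\<close> then leaves a geometric series of ratio 1/2. The summand 1 keeps
    \<open>M\<close> positive at \<open>z = 0\<close>.\<close>
  define M where "M = (2 * (norm z + 1)) powr (1 / \<beta>)"
  have "0 < 2 * (norm z + 1)" by (simp add: add_nonneg_pos)
  then have M: "M > 0" unfolding M_def powr_gt_zero by (metis less_irrefl)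
  have M': "M powr (\<beta> * real n) = (2 * (norm z + 1)) ^ n" for n
  proof -
    have "M powr (\<beta> * real n) = (2 * (norm z + 1)) powr real n"
      using assms unfolding M_def powr_powr by simp
    also have "\<dots> = (2 * (norm z + 1)) ^ n" by (intro powr_realpow) (simp add: add_nonneg_pos)
    finally show ?thesis .
  qed
  have bound: "norm (z ^ n / Gamma (of_real (\<beta> * real n + 1))) \<le> exp (M + 1) * (1/2) ^ n" if "n \<ge> 1" for n
  proof -
    have "(2 * (norm z + 1)) ^ n * exp (- M - 1) \<le> Gamma (\<beta> * real n + 1)"
      using Gamma_ge_powr[of "\<beta> * real n" M] assms M that by (simp add: M')
    moreover have pos: "Gamma (\<beta> * real n + 1) > 0" using assms by (intro Gamma_real_pos) (simp add: add_nonneg_pos)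
    moreover have "norm z ^ n * 2 ^ n \<le> (2 * (norm z + 1)) ^ n"
      unfolding power_mult_distrib[symmetric] by (intro power_mono) auto
    ultimately have "norm z ^ n * 2 ^ n * exp (- M - 1) \<le> Gamma (\<beta> * real n + 1)"
      by (meson exp_ge_zero mult_right_mono order_trans)
    then have "norm z ^ n / Gamma (\<beta> * real n + 1) \<le> exp (M + 1) * (1/2) ^ n"
      using pos by (simp add: field_simps exp_minus exp_diff exp_add)
    then show ?thesis
      using pos by (simp add: norm_divide norm_power Gamma_complex_of_real del: of_real_add of_real_mult)
  qed
  show ?thesis
    by (rule summable_comparison_test'[where N = 1, OF summable_mult[OF summable_geometric[of "1/2::real"]]])
       (use bound in auto)
qed

lemma mittag_leffler_sums:
  assumes "\<beta> > 0"
  shows "(\<lambda>n. z ^ n / Gamma (of_real (\<beta> * real n + 1))) sums mittag_leffler \<beta> z"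
  unfolding mittag_leffler_def
  by (rule summable_sums[OF summable_norm_cancel[OF summable_mittag_leffler[OF assms]]])

lemma mittag_leffler_holomorphic: "\<beta> > 0 \<Longrightarrow> mittag_leffler \<beta> holomorphic_on S"
proof -
  assume "\<beta> > 0"
  then have "mittag_leffler \<beta> holomorphic_on ball 0 r" for r
    by (intro power_series_holomorphic[where a = "\<lambda>n. 1 / Gamma (of_real (\<beta> * real n + 1))"])
       (use mittag_leffler_sums in auto)
  then have "mittag_leffler \<beta> analytic_on {z}" for z
    by (auto simp: analytic_at intro!: exI[of _ "ball 0 (norm z + 1)"])
  then show ?thesis
    using analytic_imp_holomorphic analytic_on_analytic_at by blast
qed

lemma mittag_leffler_0: "\<beta> > 0 \<Longrightarrow> mittag_leffler \<beta> 0 = 1"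
  using sums_unique2[OF mittag_leffler_sums[of \<beta> 0]
      powser_sums_zero[of "\<lambda>n. 1 / Gamma (of_real (\<beta> * real n + 1))", unfolded times_divide_eq_left mult_1]]
  by simp

text \<open>
  The weights sum up to the value at the origin of the Taylor series at \<open>-lam\<close>, so their positive
  parts have a nonzero sum whether or not the weights are known to be nonnegative.
\<close>

lemma fractional_poisson_mass:
  assumes "lam > 0" "\<beta> > 0"
  shows "measure (fractional_poisson lam \<beta>) UNIV \<noteq> 0"
proof -
  define w where "w = fractional_poisson_weight lam \<beta>"
  define t where "t n = (deriv ^^ n) (mittag_leffler \<beta>) (- of_real lam) / fact n" for n
  have "(\<lambda>n. t n * (z + of_real lam) ^ n) sums mittag_leffler \<beta> z" for z
    unfolding t_def
    using holomorphic_power_series[OF mittag_leffler_holomorphic[OF assms(2)], of z "- of_real lam" "norm (z + of_real lam) + 1"]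
    by (simp add: dist_norm norm_minus_commute add.commute)
  then have sums: "(\<lambda>n. t n * z ^ n) sums mittag_leffler \<beta> (z - of_real lam)" for z
    by (metis diff_add_cancel)
  have Re_t: "Re (t n * of_real lam ^ n) = w n" for n
  proof -
    have "t n * of_real lam ^ n = of_real (lam ^ n / fact n) * (deriv ^^ n) (mittag_leffler \<beta>) (- of_real lam)"
      by (simp add: t_def)
    then show ?thesis unfolding w_def fractional_poisson_weight_def scaleR_conv_of_real[symmetric] by simp
  qed
  have "w sums 1"
    using sums_Re[OF sums[of "of_real lam"]] assms unfolding Re_t by (simp add: mittag_leffler_0)
  have "summable (\<lambda>n. norm (t n * of_real lam ^ n))"
    using powser_insidea[OF sums_summable[OF sums[of "of_real (lam + 1)"]], of "of_real lam"] assms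
    by (simp add: norm_of_real)
  \<comment> \<open>An infinite \<open>emeasure\<close> would give \<open>measure\<close> 0, so
    finiteness of this sum matters as much as the lower bound.\<close>
  then have summable: "summable (\<lambda>n. max 0 (w n))"
  proof (rule summable_comparison_test'[where N = 0])
    show "norm (max 0 (w n)) \<le> norm (t n * of_real lam ^ n)" for n
      using abs_Re_le_cmod[of "t n * of_real lam ^ n"] unfolding Re_t by simp
  qed
  have "1 \<le> (\<Sum>n. max 0 (w n))"
    using sums_le[OF _ \<open>w sums 1\<close> summable_sums[OF summable]] by simp
  have "emeasure (fractional_poisson lam \<beta>) UNIV = (\<Sum>n. ennreal (w n))"
    unfolding fractional_poisson_def w_def
    by (subst emeasure_distr) (auto simp: emeasure_density nn_integral_count_space_nat)
  also have "\<dots> = (\<Sum>n. ennreal (max 0 (w n)))"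
    by (intro suminf_cong) (simp add: max_def ennreal_neg)
  also have "\<dots> = ennreal (\<Sum>n. max 0 (w n))" using summable by (intro suminf_ennreal2) auto
  finally show ?thesis using \<open>1 \<le> _\<close> by (simp add: measure_def)
qed

section \<open>Uniqueness of Appell series\<close>

lemma has_fps_expansion_Abs_fpsI:
  fixes f :: "complex \<Rightarrow> complex"
  assumes "\<forall>\<^sub>F z in nhds 0. (\<lambda>n. z ^ n * a n) sums f z"
  shows "f has_fps_expansion Abs_fps a"
  using assms by (intro has_fps_expansionI) (simp add: mult.commute)

section \<open>Generating function of the Appell polynomials\<close>

lemma wick_exp_Ln:
  assumes "z \<noteq> -1"
  shows "wick_exp lam \<beta> (Ln (1 + z)) x = exp (Ln (1 + z) * of_real x) / mittag_leffler \<beta> (of_real lam * z)"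
proof -
  have "1 + z \<noteq> 0" using assms by (metis add.commute add_eq_0_iff)
  then show ?thesis by (simp add: wick_exp_def)
qed

text \<open>The denominator \<open>mittag_leffler \<beta> (of_real lam * z)\<close> is entire,
  equals 1 at the origin and does not involve \<open>x\<close>, so one disc serves all
  \<open>x\<close>, whereas the definition of \<open>appell\<close> lets the neighbourhood vary with
  \<open>x\<close>. Uniqueness of Taylor coefficients settles the \<open>THE\<close>.\<close>

lemma appell_sums:
  assumes "\<beta> > 0"
  obtains r where "0 < r" "r \<le> 1"
    "\<And>z x. norm z < r \<Longrightarrow>
       (\<lambda>n. z ^ n / fact n * appell lam \<beta> n x) sums wick_exp lam \<beta> (Ln (1 + z)) x"
proof -
  define h where "h z = mittag_leffler \<beta> (of_real lam * z)" for z
  have h: "h holomorphic_on UNIV"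
    using holomorphic_on_compose[of "\<lambda>z. of_real lam * z" UNIV "mittag_leffler \<beta>"]
      mittag_leffler_holomorphic[OF assms]
    by (auto simp: h_def[abs_def] o_def intro: holomorphic_intros)
  then have "isCont h 0"
    using holomorphic_on_imp_continuous_on continuous_on_eq_continuous_at by blast
  moreover have "h 0 \<noteq> 0" using assms by (simp add: h_def mittag_leffler_0)
  ultimately have "\<forall>\<^sub>F z in nhds 0. h z \<noteq> 0"
    by (intro tendsto_imp_eventually_ne[of h "h 0"]) (auto simp: continuous_at tendsto_at_iff_tendsto_nhds)
  then obtain d where d: "d > 0" "\<And>z. dist z 0 < d \<Longrightarrow> h z \<noteq> 0"
    unfolding eventually_nhds_metric by blast
  \<comment> \<open>The bound 1 keeps \<open>1 + z\<close> off the branch cut of \<open>Ln\<close>;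
    the bound \<open>d\<close> avoids the zeros of \<open>h\<close>.\<close>
  define r where "r = min 1 d"
  have r: "0 < r" "r \<le> 1" using d(1) by (auto simp: r_def)
  define f where "f x z = wick_exp lam \<beta> (Ln (1 + z)) x" for x :: real and z
  define C where "C n x = (deriv ^^ n) (f x) 0" for n x
  have "f x holomorphic_on ball 0 r" for x
  proof -
    have not_neg: "1 + z \<notin> \<real>\<^sub>\<le>\<^sub>0" if "z \<in> ball 0 r" for z :: complex
    proof -
      have "\<bar>Re z\<bar> < 1" using that r(2) abs_Re_le_cmod[of z] by simp
      then show ?thesis by (auto simp: complex_nonpos_Reals_iff)
    qed
    have "(\<lambda>z. exp (Ln (1 + z) * of_real x) / h z) holomorphic_on ball 0 r"
      using not_neg d(2) h by (intro holomorphic_intros) (auto simp: r_def intro: holomorphic_on_subset)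
    then show ?thesis
    proof (rule holomorphic_transform)
      show "exp (Ln (1 + z) * of_real x) / h z = f x z" if "z \<in> ball 0 r" for z
        using that r by (subst f_def, subst wick_exp_Ln) (auto simp: h_def)
    qed
  qed
  then have sums: "(\<lambda>n. z ^ n / fact n * C n x) sums f x z" if "norm z < r" for z x
    using holomorphic_power_series[of "f x" 0 r z] that by (simp add: C_def mult.commute)
  have ev: "\<forall>\<^sub>F z in nhds 0. (\<lambda>n. z ^ n / fact n * C n x) sums f x z" for x
    using r(1) sums unfolding eventually_nhds_metric by (intro exI[of _ r]) auto
  have "appell lam \<beta> = C"
    unfolding appell_def f_def[symmetric]
  proof (rule the_equality)
    fix D assume D: "\<forall>x. \<forall>\<^sub>F z in nhds 0. (\<lambda>n. z ^ n / fact n * D n x) sums f x z"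
    have "Abs_fps (\<lambda>n. D n x / fact n) = Abs_fps (\<lambda>n. C n x / fact n)" for x
      using ev D by (intro fps_expansion_unique_complex[of "f x"] has_fps_expansion_Abs_fpsI) auto
    then have "D n x / fact n = C n x / fact n" for n x
      by (metis fps_nth_Abs_fps)
    then show "D = C" by (simp add: fun_eq_iff)
  qed (use ev in blast)
  then show thesis using that r sums unfolding f_def by simp
qed

lemma appell_has_fps_expansion:
  assumes "\<beta> > 0"
  shows "(\<lambda>z. wick_exp lam \<beta> (Ln (1 + z)) x) has_fps_expansion Abs_fps (\<lambda>n. appell lam \<beta> n x / fact n)"
proof -
  obtain r where r: "0 < r" "r \<le> 1"
    "\<And>z x. norm z < r \<Longrightarrow> (\<lambda>n. z ^ n / fact n * appell lam \<beta> n x) sums wick_exp lam \<beta> (Ln (1 + z)) x"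
    by (rule appell_sums[OF assms, where lam = lam]) blast
  show ?thesis
    using r unfolding eventually_nhds_metric
    by (intro has_fps_expansion_Abs_fpsI) (auto simp: eventually_nhds_metric intro!: exI[of _ r])
qed

lemma appell_0_at_0: "\<beta> > 0 \<Longrightarrow> appell lam \<beta> 0 0 = 1"
  using has_fps_expansion_imp_0_eq_fps_nth_0[OF appell_has_fps_expansion[of \<beta> lam 0]]
  by (simp add: wick_exp_def mittag_leffler_0)

text \<open>Passing from \<open>x\<close> to \<open>x + 1\<close> multiplies the generating function
  by \<open>exp (Ln (1 + z)) = 1 + z\<close>; both identities are coefficients of this product. They
  say that the forward difference lowers the index by one.\<close>

lemma appell_add_1:
  assumes "\<beta> > 0"
  shows "appell lam \<beta> (Suc n) (x + 1) / fact (Suc n) =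
           appell lam \<beta> (Suc n) x / fact (Suc n) + appell lam \<beta> n x / fact n" (is ?A)
    and "appell lam \<beta> 0 (x + 1) = appell lam \<beta> 0 x" (is ?B)
proof -
  let ?f = "\<lambda>x z. wick_exp lam \<beta> (Ln (1 + z)) x" and ?F = "\<lambda>x. Abs_fps (\<lambda>n. appell lam \<beta> n x / fact n)"
  have F: "(\<lambda>z. (1 + z) * ?f x z) has_fps_expansion (1 + fps_X) * ?F x"
    by (intro fps_expansion_intros appell_has_fps_expansion assms)
  have "\<forall>\<^sub>F z in nhds 0. z \<noteq> (-1 :: complex)"
    by (intro t1_space_nhds) auto
  then have "\<forall>\<^sub>F z in nhds 0. ?f (x + 1) z = (1 + z) * ?f x z"
  proof eventually_elim
    case (elim z)
    then have "1 + z \<noteq> 0" by (metis add.commute add_eq_0_iff)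
    then show ?case using elim by (simp add: wick_exp_Ln exp_add ring_distribs)
  qed
  then have "?f (x + 1) has_fps_expansion (1 + fps_X) * ?F x"
    using F has_fps_expansion_cong by fastforce
  then have eq: "?F (x + 1) = (1 + fps_X) * ?F x"
    using appell_has_fps_expansion[OF assms] fps_expansion_unique_complex by blast
  show ?A using arg_cong[OF eq, of "\<lambda>F. fps_nth F (Suc n)"] by (simp add: ring_distribs)
  show ?B using arg_cong[OF eq, of "\<lambda>F. fps_nth F 0"] by (simp add: ring_distribs)
qed

text \<open>The terms of the generating series at the point \<open>r / 2\<close> of its disc are
  bounded, whence \<open>\<rho> = 2 / r\<close>.\<close>

lemma appell_bound:
  assumes "\<beta> > 0"
  obtains M \<rho> where "M > 0" "\<rho> > 0" "\<And>n. norm (appell lam \<beta> n x / fact n) \<le> M * \<rho> ^ n"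
proof -
  obtain r where r: "0 < r" "r \<le> 1"
    "\<And>z x. norm z < r \<Longrightarrow> (\<lambda>n. z ^ n / fact n * appell lam \<beta> n x) sums wick_exp lam \<beta> (Ln (1 + z)) x"
    by (rule appell_sums[OF assms, where lam = lam]) blast
  define w where "w = complex_of_real (r / 2)"
  have "norm w < r" using r(1) by (simp add: w_def)
  then have "summable (\<lambda>n. w ^ n / fact n * appell lam \<beta> n x)" using r(3) sums_summable by blast
  then obtain M where M: "M > 0" "\<And>n. norm (w ^ n / fact n * appell lam \<beta> n x) \<le> M"
    by (rule BseqE[OF summable_imp_Bseq]) blast
  have "norm (appell lam \<beta> n x / fact n) \<le> M * (2 / r) ^ n" for n
    using M(2)[of n] r(1) by (simp add: w_def norm_mult norm_divide norm_power field_simps)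
  then show thesis using M(1) r(1) by (intro that[of M "2 / r"]) auto
qed

text \<open>
  The first term of the series dominates the rest by a factor of \<open>2\<close> in the weighted supremum
  norm \<open>sup \<bar>b n\<bar> / t ^ n\<close>, so that this norm vanishes.
\<close>

lemma shifted_series_eq_0_imp_eq_0:
  fixes e b :: "nat \<Rightarrow> complex"
  assumes e: "\<And>n. norm (e n) \<le> M * \<rho> ^ n" "e 0 = 1" and b: "\<And>n. norm (b n) \<le> K * t ^ n"
    and pos: "M > 0" "\<rho> > 0" "t > 0" and small: "4 * \<rho> * t * (1 + M) \<le> 1"
    and sums: "\<And>k. (\<lambda>j. e j * b (k + j)) sums 0"
  shows "b n = 0"
proof -
  \<comment> \<open>With \<open>s = \<rho> * t\<close> the smallness condition reads
    \<open>4 * s + 4 * s * M \<le> 1\<close>, which yields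
    \<open>M * s / (1 - s) \<le> 1 / 2\<close>.\<close>
  have st: "\<rho> * t > 0" "\<rho> * t * M > 0" "4 * (\<rho> * t) + 4 * (\<rho> * t * M) \<le> 1"
    using small pos by (simp_all add: algebra_simps)
  then have "3 * (\<rho> * t) + 4 * (\<rho> * t * M) < 1" "\<rho> * t < 1" by linarith+
  have geom: "(\<lambda>j. (\<rho> * t) ^ j) sums (1 / (1 - \<rho> * t))"
    using st by (intro geometric_sums) auto
  \<comment> \<open>Each round halves the bound for all \<open>b k\<close> at once; \<open>k\<close>
    is arbitrary because \<open>b k\<close> is controlled by later entries.\<close>
  have bound: "norm (b k) \<le> K * t ^ k / 2 ^ i" for i k
  proof (induction i arbitrary: k)
    case 0
    then show ?case using b by simp
  next
    case (Suc i)
    have K: "K \<ge> 0" using b[of 0] norm_ge_zero[of "b 0"] by (simp del: norm_ge_zero)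
    \<comment> \<open>Since \<open>e 0 = 1\<close>, the relation expresses \<open>- b k\<close>
      through the entries after \<open>b k\<close>.\<close>
    have s: "(\<lambda>j. e (Suc j) * b (k + Suc j)) sums (- b k)"
      using sums[of k] by (subst sums_Suc_iff) (simp add: e(2))
    have term_le: "norm (e (Suc j) * b (k + Suc j)) \<le> M * (\<rho> * t) * K * t ^ k / 2 ^ i * (\<rho> * t) ^ j" for j
    proof -
      have "norm (e (Suc j)) * norm (b (k + Suc j)) \<le> (M * \<rho> ^ Suc j) * (K * t ^ (k + Suc j) / 2 ^ i)"
        using pos by (intro mult_mono e Suc) auto
      also have "\<dots> = M * (\<rho> * t) * K * t ^ k / 2 ^ i * (\<rho> * t) ^ j"
        by (simp add: power_add power_mult_distrib)
      finally show ?thesis by (simp add: norm_mult)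
    qed
    have "norm (b k) = norm (\<Sum>j. e (Suc j) * b (k + Suc j))"
      using sums_unique[OF s] by (metis norm_minus_cancel)
    also have "\<dots> \<le> (\<Sum>j. M * (\<rho> * t) * K * t ^ k / 2 ^ i * (\<rho> * t) ^ j)"
      by (intro norm_suminf_le term_le summable_mult sums_summable[OF geom])
    also have "\<dots> = M * (\<rho> * t) * K * t ^ k / 2 ^ i * (1 / (1 - \<rho> * t))"
      by (intro sums_unique[symmetric] sums_mult geom)
    also have "\<dots> = (M * (\<rho> * t) / (1 - \<rho> * t)) * (K * t ^ k / 2 ^ i)" by (simp add: mult_ac)
    also have "\<dots> \<le> (1 / 2) * (K * t ^ k / 2 ^ i)"
    proof (rule mult_right_mono)
      show "M * (\<rho> * t) / (1 - \<rho> * t) \<le> 1 / 2" using st by (simp add: divide_simps mult.commute)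
    qed (use pos K in auto)
    finally show ?case by simp
  qed
  have "(\<lambda>i. K * t ^ n * (1 / 2) ^ i) \<longlonglongrightarrow> K * t ^ n * 0"
    by (intro tendsto_intros LIMSEQ_power_zero) auto
  moreover have "norm (b n) \<le> K * t ^ n * (1 / 2) ^ i" for i
    using bound[of n i] by (simp add: power_one_over)
  ultimately have "norm (b n) \<le> 0" using LIMSEQ_le_const by fastforce
  then show ?thesis by simp
qed

text \<open>Summable terms are bounded, and the square root halves the exponent of the weight
  \<open>2 ^ (n * q)\<close>. The resulting ratio tends to 0 as \<open>q\<close> grows, which is the
  source of uniqueness for large \<open>q\<close>.\<close>

lemma test_coeffs_bound:
  assumes "a \<in> test_coeffs q"
  obtains K where "\<And>n. norm (fact n * a n) \<le> K * ((1 / sqrt 2) ^ q) ^ n"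
proof -
  have "summable (\<lambda>n. (fact n)\<^sup>2 * 2 ^ (n * q) * (cmod (a n))\<^sup>2)" using assms by (simp add: test_coeffs_def)
  then obtain B where B: "B > 0" "\<And>n. norm ((fact n)\<^sup>2 * 2 ^ (n * q) * (cmod (a n))\<^sup>2) \<le> B"
    by (rule BseqE[OF summable_imp_Bseq]) blast
  have "norm (fact n * a n) \<le> sqrt B * ((1 / sqrt 2) ^ q) ^ n" for n
  proof -
    have "((sqrt 2 ^ q) ^ n)\<^sup>2 = ((sqrt 2)\<^sup>2) ^ (n * q)"
      by (simp only: power_mult[symmetric] mult_ac)
    then have sqrt: "((sqrt 2 ^ q) ^ n)\<^sup>2 = 2 ^ (n * q)" by simp
    have "(norm (fact n * a n) * (sqrt 2 ^ q) ^ n)\<^sup>2 \<le> B"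
      using B(2)[of n] by (simp add: norm_mult power_mult_distrib sqrt mult_ac)
    then have "norm (fact n * a n) * (sqrt 2 ^ q) ^ n \<le> sqrt B" by (rule real_le_rsqrt)
    then show ?thesis by (simp add: power_one_over field_simps)
  qed
  then show thesis using that by blast
qed

text \<open>
  Evaluating the series at the natural numbers and taking differences gives the relations
  \<open>\<Sum>j. c j * b (k + j) = 0\<close> for all \<open>k\<close>, where \<open>b n = n! a n\<close> and \<open>c j = C j 0 / j!\<close>.
\<close>

lemma appell_series_unique:
  assumes "\<beta> > 0"
  shows "\<forall>\<^sub>F q in sequentially. \<forall>a\<in>test_coeffs q. \<forall>a'\<in>test_coeffs q. \<forall>\<phi>.
    (\<forall>x. (\<lambda>n. a n * appell lam \<beta> n x) sums \<phi> x) \<longrightarrow> (\<forall>x. (\<lambda>n. a' n * appell lam \<beta> n x) sums \<phi> x) \<longrightarrow> a = a'"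
proof -
  define c where "c n x = appell lam \<beta> n x / fact n" for n x
  have c_add_1: "c (Suc n) (x + 1) = c (Suc n) x + c n x" "c 0 (x + 1) = c 0 x" for n x
    unfolding c_def using appell_add_1[OF assms] by auto
  obtain M \<rho> where M: "M > 0" "\<rho> > 0" "\<And>n. norm (c n 0) \<le> M * \<rho> ^ n"
    unfolding c_def by (rule appell_bound[OF assms, where lam = lam and x = 0]) blast
  \<comment> \<open>\<open>M\<close> and \<open>\<rho>\<close> come from the Appell polynomials and
    are fixed before \<open>q\<close>, so a large \<open>q\<close> achieves the smallness.\<close>
  have "(\<lambda>q. 4 * \<rho> * (1 / sqrt 2) ^ q * (1 + M)) \<longlonglongrightarrow> 4 * \<rho> * 0 * (1 + M)"
    by (intro tendsto_intros LIMSEQ_power_zero) auto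
  then have "\<forall>\<^sub>F q in sequentially. 4 * \<rho> * (1 / sqrt 2) ^ q * (1 + M) < 1"
    by (rule order_tendstoD) auto
  then show ?thesis
  proof (eventually_elim, intro ballI allI impI)
    fix q a a' \<phi>
    assume q: "4 * \<rho> * (1 / sqrt 2) ^ q * (1 + M) < 1"
      and a: "a \<in> test_coeffs q" "\<forall>x. (\<lambda>n. a n * appell lam \<beta> n x) sums \<phi> x"
      and a': "a' \<in> test_coeffs q" "\<forall>x. (\<lambda>n. a' n * appell lam \<beta> n x) sums \<phi> x"
    obtain K where K: "\<And>n. norm (fact n * a n) \<le> K * ((1 / sqrt 2) ^ q) ^ n"
      by (rule test_coeffs_bound[OF a(1)]) blast
    obtain K' where K': "\<And>n. norm (fact n * a' n) \<le> K' * ((1 / sqrt 2) ^ q) ^ n"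
      by (rule test_coeffs_bound[OF a'(1)]) blast
    define b where "b n = fact n * (a n - a' n)" for n
    have bound: "norm (b n) \<le> (K + K') * ((1 / sqrt 2) ^ q) ^ n" for n
      using norm_triangle_ineq4[of "fact n * a n" "fact n * a' n"] K[of n] K'[of n]
      by (simp add: b_def algebra_simps)
    \<comment> \<open>\<open>m\<close> stays arbitrary: the step to \<open>Suc k\<close> at
      \<open>m\<close> subtracts the relations for \<open>k\<close> at \<open>m + 1\<close> and at
      \<open>m\<close>.\<close>
    have "(\<lambda>n. b (k + n) * c n (real m)) sums 0" for k m
    proof (induction k arbitrary: m)
      case 0
      have "(\<lambda>n. a n * appell lam \<beta> n (real m) - a' n * appell lam \<beta> n (real m)) sums (\<phi> (real m) - \<phi> (real m))"
        using a(2) a'(2) by (intro sums_diff) auto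
      then show ?case by (simp add: b_def c_def algebra_simps)
    next
      case (Suc k)
      have "(\<lambda>n. b (k + n) * c n (real m + 1) - b (k + n) * c n (real m)) sums (0 - 0)"
        using Suc[of "Suc m"] Suc[of m] by (intro sums_diff) (simp_all add: add.commute)
      \<comment> \<open>The term of index 0 drops out because \<open>c 0\<close> is unchanged by the
        shift of its argument.\<close>
      then have "(\<lambda>n. b (k + Suc n) * c (Suc n) (real m + 1) - b (k + Suc n) * c (Suc n) (real m)) sums 0"
        by (subst sums_Suc_iff) (simp add: c_add_1)
      then show ?case by (simp add: c_add_1 ring_distribs)
    qed
    from this[where m = 0] have "(\<lambda>n. c n 0 * b (k + n)) sums 0" for k
      by (simp add: mult.commute)
    then have "b n = 0" for n
      using shifted_series_eq_0_imp_eq_0[of "\<lambda>n. c n 0", OF M(3) _ bound M(1,2)] q assms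
      by (simp add: c_def appell_0_at_0)
    then show "a = a'" by (simp add: b_def fun_eq_iff)
  qed
qed

text \<open>For small \<open>z\<close> the substitution \<open>w = exp z - 1\<close> is undone by
  \<open>Ln (1 + w)\<close>, so the generating series is the required expansion. The neighbourhood
  of 0 depends on \<open>q\<close>, hence the order of the two eventualities.\<close>

lemma appell_coeff_wick_exp:
  assumes "\<beta> > 0"
  shows "\<forall>\<^sub>F q in sequentially. \<forall>\<^sub>F z in nhds 0.
           appell_coeff lam \<beta> q (wick_exp lam \<beta> z) = (\<lambda>n. (exp z - 1) ^ n / fact n)"
  using appell_series_unique[OF assms, of lam]
proof eventually_elim
  fix q
  assume unique: "\<forall>a\<in>test_coeffs q. \<forall>a'\<in>test_coeffs q. \<forall>\<phi>.
    (\<forall>x. (\<lambda>n. a n * appell lam \<beta> n x) sums \<phi> x) \<longrightarrow> (\<forall>x. (\<lambda>n. a' n * appell lam \<beta> n x) sums \<phi> x) \<longrightarrow> a = a'"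
  obtain r where r: "0 < r" "r \<le> 1"
    "\<And>z x. norm z < r \<Longrightarrow> (\<lambda>n. z ^ n / fact n * appell lam \<beta> n x) sums wick_exp lam \<beta> (Ln (1 + z)) x"
    by (rule appell_sums[OF assms, where lam = lam]) blast
  have lim: "((\<lambda>z::complex. exp z - 1) \<longlongrightarrow> exp 0 - 1) (nhds 0)"
    by (intro tendsto_intros filterlim_ident)
  \<comment> \<open>The squared norm of these coefficients is a geometric series, and this
    expression is its ratio.\<close>
  have "((\<lambda>z::complex. 2 ^ q * (norm (exp z - 1))\<^sup>2) \<longlongrightarrow> 2 ^ q * (norm (exp 0 - 1 :: complex))\<^sup>2) (nhds 0)"
    by (intro tendsto_intros filterlim_ident)
  then have "\<forall>\<^sub>F z::complex in nhds 0. 2 ^ q * (norm (exp z - 1))\<^sup>2 < 1"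
    by (rule order_tendstoD) simp
  moreover have "\<forall>\<^sub>F z::complex in nhds 0. norm (exp z - 1) < r"
    using order_tendstoD(2)[OF tendsto_norm[OF lim]] r(1) by simp
  moreover have "\<forall>\<^sub>F z::complex in nhds 0. norm z < pi"
    by (auto simp: eventually_nhds_metric intro!: exI[of _ pi])
  ultimately show "\<forall>\<^sub>F z in nhds 0. appell_coeff lam \<beta> q (wick_exp lam \<beta> z) = (\<lambda>n. (exp z - 1) ^ n / fact n)"
  proof eventually_elim
    case (elim z)
    have "\<bar>Im z\<bar> < pi" using elim(3) abs_Im_le_cmod[of z] by linarith
    then have Ln: "Ln (exp z) = z" by (intro Ln_exp) auto
    have "(fact n)\<^sup>2 * 2 ^ (n * q) * (norm ((exp z - 1) ^ n / fact n))\<^sup>2 = (2 ^ q * (norm (exp z - 1))\<^sup>2) ^ n" for n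
      by (simp add: norm_divide norm_power power_divide power_mult_distrib mult.commute flip: power_mult)
    then have mem: "(\<lambda>n. (exp z - 1) ^ n / fact n) \<in> test_coeffs q"
      using elim(1) by (simp add: test_coeffs_def summable_geometric_iff)
    have sums: "\<forall>x. (\<lambda>n. (exp z - 1) ^ n / fact n * appell lam \<beta> n x) sums wick_exp lam \<beta> z x"
      using r(3)[OF elim(2)] Ln by simp
    show ?case
      unfolding appell_coeff_def
    proof (rule the_equality, intro conjI mem sums)
      fix a assume "a \<in> test_coeffs q \<and> (\<forall>x. (\<lambda>n. a n * appell lam \<beta> n x) sums wick_exp lam \<beta> z x)"
      then show "a = (\<lambda>n. (exp z - 1) ^ n / fact n)"
        by (intro unique[rule_format, of a _ "wick_exp lam \<beta> z"] mem sums[rule_format]) auto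
    qed
  qed
qed

section \<open>Coefficients of generalized functions\<close>

lemma fdiff_0 [simp]: "fdiff 0 = 0"
  by (simp add: fdiff_def)

lemma fdiff_smult: "fdiff (smult a p) = smult a (fdiff p)"
  by (simp add: fdiff_def pcompose_smult smult_diff_right)

lemma funpow_fdiff_smult: "(fdiff ^^ n) (smult a p) = smult a ((fdiff ^^ n) p)"
  by (induction n) (auto simp: fdiff_smult)

text \<open>A polynomial and its translate have the same degree and leading coefficient, so the top
  terms cancel.\<close>

lemma coeff_fdiff_eq_0:
  assumes "degree p \<le> n"
  shows "coeff (fdiff p) n = 0"
proof (cases "degree p = n")
  case True
  then show ?thesis
    using lead_coeff_comp[of "[:1, 1:]" p] by (simp add: fdiff_def degree_pcompose)
next
  case False
  then have "degree p < n" using assms by simp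
  then show ?thesis by (simp add: fdiff_def coeff_eq_0 degree_pcompose)
qed

lemma funpow_fdiff_eq_0: "degree p < n \<Longrightarrow> (fdiff ^^ n) p = 0"
proof (induction n arbitrary: p)
  case (Suc n)
  show ?case
  proof (cases "fdiff p = 0")
    case True
    have "(fdiff ^^ n) 0 = 0" by (induction n) auto
    then show ?thesis using True by (simp add: funpow_Suc_right del: funpow.simps)
  next
    case False
    then have "degree (fdiff p) < n"
      using Suc.prems coeff_fdiff_eq_0[of p "degree (fdiff p)"] by (meson leading_coeff_0_iff less_Suc_eq_le not_le order_less_le_trans)
    then show ?thesis using Suc.IH by (simp add: funpow_Suc_right del: funpow.simps)
  qed
qed simp

text \<open>The falling factorials \<open>x (x - 1) ... (x - n + 1)\<close>, on which forward
  differences act as derivatives act on powers. They are the test polynomials because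
  \<open>appell\<close> yields functions, while the functionals take a
  \<open>complex poly\<close>.\<close>

fun falling_poly :: "nat \<Rightarrow> complex poly" where
  "falling_poly 0 = 1"
| "falling_poly (Suc n) = falling_poly n * [:- of_nat n, 1:]"

text \<open>The shift moves every factor onto its predecessor: \<open>x + 1\<close> is new and the
  last factor is lost.\<close>

lemma pcompose_falling_poly: "pcompose (falling_poly (Suc n)) [:1, 1:] = [:1, 1:] * falling_poly n"
proof (induction n)
  case (Suc n)
  have "pcompose (falling_poly (Suc (Suc n))) [:1, 1:] = ([:1, 1:] * falling_poly n) * [:- of_nat n, 1:]"
    by (subst falling_poly.simps(2), subst pcompose_mult, subst Suc.IH) (simp add: pcompose_pCons)
  then show ?case by (simp only: falling_poly.simps mult_ac)
qed (simp add: pcompose_pCons)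

lemma fdiff_falling_poly: "fdiff (falling_poly (Suc n)) = smult (of_nat (Suc n)) (falling_poly n)"
proof -
  have "fdiff (falling_poly (Suc n)) = [:1, 1:] * falling_poly n - falling_poly (Suc n)"
    by (simp only: fdiff_def pcompose_falling_poly)
  also have "\<dots> = ([:1, 1:] - [:- of_nat n, 1:]) * falling_poly n"
    by (simp only: falling_poly.simps left_diff_distrib) (simp only: mult.commute)
  finally show ?thesis by (simp add: add.commute)
qed

lemma funpow_fdiff_falling_poly: "(fdiff ^^ n) (falling_poly n) = [:fact n:]"
proof (induction n)
  case (Suc n)
  then show ?case
    by (simp only: funpow_Suc_right o_apply fdiff_falling_poly funpow_fdiff_smult) simp
qed (simp add: one_pCons)

lemma funpow_fdiff_falling_poly_eq_0:
  assumes "n < m"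
  shows "(fdiff ^^ m) (falling_poly n) = 0"
proof -
  have "m = (m - n) + n" using assms by simp
  then have "(fdiff ^^ m) (falling_poly n) = (fdiff ^^ (m - n)) [:fact n:]"
    by (metis funpow_add o_apply funpow_fdiff_falling_poly)
  then show ?thesis using assms by (simp add: funpow_fdiff_eq_0)
qed

lemma dual_series_eq_sum:
  assumes "\<And>m. n < m \<Longrightarrow> (fdiff ^^ m) p = 0"
  shows "dual_series lam \<beta> c p = (\<Sum>m\<le>n. c m * dual_appell lam \<beta> m p)"
  unfolding dual_series_def using assms by (intro suminf_finite) (auto simp: dual_appell_def)

lemma dual_series_eq_sum_degree: "dual_series lam \<beta> c p = (\<Sum>m\<le>degree p. c m * dual_appell lam \<beta> m p)"
  by (intro dual_series_eq_sum funpow_fdiff_eq_0)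

lemma dual_series_add: "dual_series lam \<beta> (\<lambda>n. c n + d n) = dual_series lam \<beta> c + dual_series lam \<beta> d"
  by (simp add: fun_eq_iff dual_series_eq_sum_degree ring_distribs sum.distrib)

lemma dual_series_scaleR: "dual_series lam \<beta> (\<lambda>n. r *\<^sub>R c n) = r *\<^sub>R dual_series lam \<beta> c"
  by (simp add: fun_eq_iff scaleR_fun_def dual_series_eq_sum_degree scaleR_sum_right)

text \<open>
  The matrix of the dual Appell functionals on the falling factorials is triangular, and its
  diagonal entries are factorials times the total mass.
\<close>

lemma dual_series_inject:
  assumes "lam > 0" "\<beta> > 0" and eq: "dual_series lam \<beta> c = dual_series lam \<beta> d"
  shows "c = d"
proof
  fix n
  show "c n = d n"
  proof (induction n rule: less_induct)
    case (less n)
    have "dual_appell lam \<beta> n (falling_poly n) = measure (fractional_poisson lam \<beta>) UNIV *\<^sub>R fact n"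
      by (simp add: dual_appell_def funpow_fdiff_falling_poly) (simp add: fractional_poisson_def)
    then have "dual_appell lam \<beta> n (falling_poly n) \<noteq> 0"
      using fractional_poisson_mass assms by simp
    moreover have "(\<Sum>m\<le>n. c m * dual_appell lam \<beta> m (falling_poly n)) = (\<Sum>m\<le>n. d m * dual_appell lam \<beta> m (falling_poly n))"
      using fun_cong[OF eq, of "falling_poly n"] by (simp add: dual_series_eq_sum[of n] funpow_fdiff_falling_poly_eq_0)
    moreover have "(\<Sum>m<n. c m * dual_appell lam \<beta> m (falling_poly n)) = (\<Sum>m<n. d m * dual_appell lam \<beta> m (falling_poly n))"
      using less by simp
    ultimately show ?case by (simp add: lessThan_Suc_atMost[symmetric])
  qed
qed

lemma dual_coeff_dual_series:
  assumes "lam > 0" "\<beta> > 0"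
  shows "dual_coeff lam \<beta> (dual_series lam \<beta> c) = c"
  unfolding dual_coeff_def using dual_series_inject[OF assms] by blast

section \<open>Weighted square-summable coefficient sequences\<close>

definition weighted_l2 :: "nat \<Rightarrow> (nat \<Rightarrow> complex) set" where
  "weighted_l2 q = {c. summable (\<lambda>n. (cmod (c n))\<^sup>2 / 2 ^ (n * q))}"

definition weighted_norm :: "nat \<Rightarrow> (nat \<Rightarrow> complex) \<Rightarrow> real" where
  "weighted_norm q c = sqrt (\<Sum>n. (cmod (c n))\<^sup>2 / 2 ^ (n * q))"

lemma gen_space_eq_image: "gen_space lam \<beta> q = dual_series lam \<beta> ` weighted_l2 q"
  unfolding gen_space_def weighted_l2_def by blast

lemma gen_norm_dual_series:
  "lam > 0 \<Longrightarrow> \<beta> > 0 \<Longrightarrow> gen_norm lam \<beta> q (dual_series lam \<beta> c) = weighted_norm q c"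
  by (simp add: gen_norm_def weighted_norm_def dual_coeff_dual_series)

lemma weighted_l2_add:
  assumes "c \<in> weighted_l2 q" "d \<in> weighted_l2 q"
  shows "(\<lambda>n. c n + d n) \<in> weighted_l2 q"
proof -
  have "summable (\<lambda>n. 2 * ((cmod (c n))\<^sup>2 / 2 ^ (n * q)) + 2 * ((cmod (d n))\<^sup>2 / 2 ^ (n * q)))"
    using assms by (intro summable_add summable_mult) (auto simp: weighted_l2_def)
  then have "summable (\<lambda>n. (cmod (c n + d n))\<^sup>2 / 2 ^ (n * q))"
  proof (rule summable_comparison_test'[where N = 0])
    fix n
    have "(cmod (c n + d n))\<^sup>2 \<le> (cmod (c n) + cmod (d n))\<^sup>2"
      by (intro power_mono norm_triangle_ineq) auto
    also have "\<dots> \<le> 2 * (cmod (c n))\<^sup>2 + 2 * (cmod (d n))\<^sup>2"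
      using sum_squares_bound[of "cmod (c n)" "cmod (d n)"] by (simp add: power2_sum)
    finally have "(cmod (c n + d n))\<^sup>2 / 2 ^ (n * q) \<le> (2 * (cmod (c n))\<^sup>2 + 2 * (cmod (d n))\<^sup>2) / 2 ^ (n * q)"
      by (intro divide_right_mono) auto
    then show "norm ((cmod (c n + d n))\<^sup>2 / 2 ^ (n * q)) \<le> 2 * ((cmod (c n))\<^sup>2 / 2 ^ (n * q)) + 2 * ((cmod (d n))\<^sup>2 / 2 ^ (n * q))"
      by (simp add: add_divide_distrib)
  qed
  then show ?thesis by (simp add: weighted_l2_def)
qed

lemma weighted_l2_scaleR: "c \<in> weighted_l2 q \<Longrightarrow> (\<lambda>n. r *\<^sub>R c n) \<in> weighted_l2 q"
  unfolding weighted_l2_def by (auto simp: power_mult_distrib intro: summable_mult dest: summable_mult[of _ "r\<^sup>2"])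

lemma subspace_gen_space: "subspace (gen_space lam \<beta> q)"
  unfolding subspace_def gen_space_eq_image
proof (intro conjI ballI allI)
  have "dual_series lam \<beta> (\<lambda>_. 0) = 0" by (simp add: fun_eq_iff dual_series_def)
  moreover have "(\<lambda>_. 0) \<in> weighted_l2 q" by (simp add: weighted_l2_def)
  ultimately show "0 \<in> dual_series lam \<beta> ` weighted_l2 q" by (metis imageI)
next
  fix x y assume "x \<in> dual_series lam \<beta> ` weighted_l2 q" "y \<in> dual_series lam \<beta> ` weighted_l2 q"
  then show "x + y \<in> dual_series lam \<beta> ` weighted_l2 q"
    by (auto simp flip: dual_series_add intro: weighted_l2_add)
next
  fix x r assume "x \<in> dual_series lam \<beta> ` weighted_l2 q"
  then show "r *\<^sub>R x \<in> dual_series lam \<beta> ` weighted_l2 q"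
    by (auto simp flip: dual_series_scaleR intro: weighted_l2_scaleR)
qed

lemma incseq_gen_space: "incseq (gen_space lam \<beta>)"
proof -
  have "weighted_l2 p \<subseteq> weighted_l2 q" if "p \<le> q" for p q
  proof
    fix c assume "c \<in> weighted_l2 p"
    then have "summable (\<lambda>n. (cmod (c n))\<^sup>2 / 2 ^ (n * p))" by (simp add: weighted_l2_def)
    then have "summable (\<lambda>n. (cmod (c n))\<^sup>2 / 2 ^ (n * q))"
      by (rule summable_comparison_test'[where N = 0])
         (use that in \<open>auto intro!: divide_left_mono power_increasing mult_left_mono\<close>)
    then show "c \<in> weighted_l2 q" by (simp add: weighted_l2_def)
  qed
  then show ?thesis unfolding incseq_def gen_space_eq_image by blast
qed

lemma weighted_norm_nonneg: "c \<in> weighted_l2 q \<Longrightarrow> 0 \<le> weighted_norm q c"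
  unfolding weighted_norm_def weighted_l2_def by (auto intro!: suminf_nonneg)

lemma weighted_l2_coeff_bound:
  assumes "c \<in> weighted_l2 q"
  shows "norm (c n) \<le> weighted_norm q c * (2 ^ q) ^ n"
proof -
  let ?f = "\<lambda>n. (cmod (c n))\<^sup>2 / 2 ^ (n * q)"
  have "?f n \<le> (\<Sum>n. ?f n)"
    using sum_le_suminf[of ?f "{n}"] assms by (simp add: weighted_l2_def)
  then have "(cmod (c n))\<^sup>2 \<le> (weighted_norm q c)\<^sup>2 * 2 ^ (n * q)"
    using assms by (simp add: weighted_norm_def weighted_l2_def suminf_nonneg field_simps)
  \<comment> \<open>Squaring the weight gives up the sharper ratio \<open>2 powr (q / 2)\<close> so
    that only integral powers of 2 occur.\<close>
  also have "\<dots> \<le> (weighted_norm q c)\<^sup>2 * (2 ^ (n * q))\<^sup>2"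
    by (intro mult_left_mono) (auto simp: power2_eq_square)
  also have "\<dots> = (weighted_norm q c * (2 ^ q) ^ n)\<^sup>2"
    by (simp add: power_mult_distrib mult.commute flip: power_mult)
  finally show ?thesis
    by (rule power2_le_imp_le) (simp add: weighted_norm_nonneg[OF assms])
qed

text \<open>Squaring the bound produces \<open>2 ^ (2 * m * n)\<close>; the additional 1 in the
  order leaves \<open>(1 / 2) ^ n\<close>, with sum 2. The norm is thus at most
  \<open>sqrt 2 * B\<close>, rounded up to \<open>2 * B\<close>.\<close>

lemma weighted_l2_geometric:
  assumes "\<And>n. norm (c n) \<le> B * (2 ^ m) ^ n"
  shows "c \<in> weighted_l2 (2 * m + 1)" and "weighted_norm (2 * m + 1) c \<le> 2 * B"
proof -
  have B: "B \<ge> 0" using assms[of 0] norm_ge_zero[of "c 0"] by (simp del: norm_ge_zero)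
  have le: "(cmod (c n))\<^sup>2 / 2 ^ (n * (2 * m + 1)) \<le> B\<^sup>2 * (1 / 2) ^ n" for n
  proof -
    have "(cmod (c n))\<^sup>2 \<le> (B * (2 ^ m) ^ n)\<^sup>2" by (intro power_mono assms) auto
    also have "\<dots> = B\<^sup>2 * 2 ^ (n * (2 * m + 1)) * (1 / 2) ^ n"
      by (simp add: power_mult_distrib power_add power_one_over mult.commute mult.left_commute flip: power_mult)
    finally show ?thesis by (simp add: field_simps)
  qed
  have geom: "(\<lambda>n. B\<^sup>2 * (1 / 2) ^ n) sums (B\<^sup>2 * 2)"
    using geometric_sums[of "1 / 2 :: real"] by (intro sums_mult) simp
  have s: "summable (\<lambda>n. (cmod (c n))\<^sup>2 / 2 ^ (n * (2 * m + 1)))"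
    by (rule summable_comparison_test'[where N = 0, OF sums_summable[OF geom]]) (use le in auto)
  then show "c \<in> weighted_l2 (2 * m + 1)" by (simp add: weighted_l2_def)
  have "(\<Sum>n. (cmod (c n))\<^sup>2 / 2 ^ (n * (2 * m + 1))) \<le> B\<^sup>2 * 2"
    using sums_le[OF le summable_sums[OF s] geom] .
  also have "\<dots> \<le> (2 * B)\<^sup>2" by (simp add: power2_eq_square)
  finally show "weighted_norm (2 * m + 1) c \<le> 2 * B"
    unfolding weighted_norm_def using B by (intro real_le_lsqrt) auto
qed

section \<open>Germs and the S-transform\<close>

lemma germ_eq_iff:
  assumes "f analytic_on {0}" "g analytic_on {0}"
  shows "germ f = germ g \<longleftrightarrow> (\<forall>\<^sub>F z in nhds 0. f z = g z)"
  using Quotient_rel[OF Quotient_hol0, of f g] assms by auto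

text \<open>Eventual equality carries analyticity over from \<open>g\<close> to \<open>f\<close>.
  This is how the germ of \<open>pairing\<close> is handled: its analyticity comes from its
  agreement with a power series.\<close>

lemma germ_eqI:
  assumes "g analytic_on {0}" "\<forall>\<^sub>F z in nhds 0. f z = g z"
  shows "germ f = germ g"
proof -
  have "f analytic_on {0}" using assms analytic_at_cong by blast
  then show ?thesis using assms germ_eq_iff by blast
qed

lemma germ_add:
  assumes "f analytic_on {0}" "g analytic_on {0}"
  shows "germ f + germ g = germ (\<lambda>z. f z + g z)"
  using assms by (intro plus_hol0.abs_eq) auto

lemma germ_scaleR:
  assumes "f analytic_on {0}"
  shows "r *\<^sub>R germ f = germ (\<lambda>z. of_real r * f z)"
  using assms by (intro scaleR_hol0.abs_eq) auto

lemma germ_zero: "0 = germ (\<lambda>_. 0)"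
  by (simp add: zero_hol0_def)

lemma ex_pow_cball_less:
  fixes g :: "complex \<Rightarrow> complex"
  assumes "(g \<longlongrightarrow> 0) (nhds 0)" "e > 0"
  obtains l :: nat where "\<And>z. z \<in> cball 0 (1 / 2 ^ l) \<Longrightarrow> norm (g z) < e"
proof -
  have "\<forall>\<^sub>F z in nhds 0. norm (g z) < e"
    using order_tendstoD(2)[OF tendsto_norm[OF assms(1)]] assms(2) by simp
  then obtain d where d: "d > 0" "\<And>z. dist z 0 < d \<Longrightarrow> norm (g z) < e"
    unfolding eventually_nhds_metric by blast
  obtain l where "(1 / 2) ^ l < d" using real_arch_pow_inv[of d "1 / 2"] d(1) by auto
  then have "norm (g z) < e" if "z \<in> cball 0 (1 / 2 ^ l)" for z
    using that by (intro d(2)) (simp add: power_one_over)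
  then show thesis using that by blast
qed

lemma exp_minus_1_tendsto_0: "((\<lambda>z::complex. exp z - 1) \<longlongrightarrow> 0) (nhds 0)"
proof -
  have "((\<lambda>z::complex. exp z - 1) \<longlongrightarrow> exp 0 - 1) (nhds 0)"
    by (intro tendsto_intros filterlim_ident)
  then show ?thesis by simp
qed

lemma Ln_add_1_tendsto_0: "((\<lambda>z. Ln (1 + z)) \<longlongrightarrow> 0) (nhds 0)"
proof -
  have "((\<lambda>z. Ln (1 + z)) \<longlongrightarrow> Ln (1 + 0)) (nhds 0)"
    by (intro tendsto_intros filterlim_ident) auto
  then show ?thesis by simp
qed

section \<open>Representatives on closed discs and their supremum norms\<close>

lemma disc_rep_analytic: "disc_rep l u U \<Longrightarrow> U analytic_on {0}"
  unfolding disc_rep_def analytic_at by (intro exI[of _ "ball 0 (1 / 2 ^ l)"]) auto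

text \<open>The identity theorem gives equality on the open disc and continuity extends it to the
  boundary. This makes the \<open>THE\<close> in \<open>hol0_norm\<close> well defined.\<close>

lemma disc_rep_unique:
  assumes "disc_rep l u U" "disc_rep l u V" "z \<in> cball 0 (1 / 2 ^ l)"
  shows "U z = V z"
proof -
  let ?B = "ball 0 (1 / 2 ^ l) :: complex set"
  have U: "U holomorphic_on ?B" "continuous_on (cball 0 (1 / 2 ^ l)) U"
    and V: "V holomorphic_on ?B" "continuous_on (cball 0 (1 / 2 ^ l)) V"
    using assms unfolding disc_rep_def by auto
  have "germ U = germ V" using assms unfolding disc_rep_def by metis
  then have "\<forall>\<^sub>F z in nhds 0. U z = V z"
    using germ_eq_iff disc_rep_analytic assms(1,2) by blast
  then obtain S where S: "open S" "0 \<in> S" "\<And>z. z \<in> S \<Longrightarrow> U z = V z"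
    unfolding eventually_nhds by blast
  have "0 \<in> S \<inter> ?B" using S(2) by simp
  then have "S \<inter> ?B \<noteq> {}" by blast
  have "U z = V z" if "z \<in> ?B" for z
    by (rule analytic_continuation_open[OF _ _ \<open>S \<inter> ?B \<noteq> {}\<close> _ _ U(1) V(1)]) (use S that in auto)
  then have "U z - V z = 0" if "z \<in> ?B" for z using that by simp
  moreover have "closure ?B = cball 0 (1 / 2 ^ l)" by (intro closure_ball) simp
  moreover have "continuous_on (cball 0 (1 / 2 ^ l)) (\<lambda>z. U z - V z)"
    using U(2) V(2) by (rule continuous_on_diff)
  ultimately have "U z - V z = 0"
    using assms(3) continuous_constant_on_closure[of ?B "\<lambda>z. U z - V z" 0 z] by simp
  then show ?thesis by simp
qed

lemma hol0_norm_eq: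
  assumes "disc_rep l u U"
  shows "hol0_norm l u = (SUP z\<in>cball 0 (1 / 2 ^ l). cmod (U z))"
  unfolding hol0_norm_def
proof (rule the_equality)
  fix s assume "\<exists>V. disc_rep l u V \<and> s = (SUP z\<in>cball 0 (1 / 2 ^ l). cmod (V z))"
  then obtain V where "disc_rep l u V" "s = (SUP z\<in>cball 0 (1 / 2 ^ l). cmod (V z))" by blast
  then show "s = (SUP z\<in>cball 0 (1 / 2 ^ l). cmod (U z))"
    using disc_rep_unique[OF assms] by (auto intro!: SUP_cong)
qed (use assms in blast)

lemma norm_le_hol0_norm:
  assumes "disc_rep l u U" "z \<in> cball 0 (1 / 2 ^ l)"
  shows "cmod (U z) \<le> hol0_norm l u"
proof -
  have "continuous_on (cball 0 (1 / 2 ^ l)) U" using assms(1) by (simp add: disc_rep_def)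
  then have "compact ((\<lambda>z. cmod (U z)) ` cball 0 (1 / 2 ^ l))"
    by (intro compact_continuous_image continuous_on_norm) auto
  then have "bdd_above ((\<lambda>z. cmod (U z)) ` cball 0 (1 / 2 ^ l))"
    by (intro bounded_imp_bdd_above compact_imp_bounded)
  then show ?thesis
    unfolding hol0_norm_eq[OF assms(1)] using assms(2) by (intro cSUP_upper)
qed

lemma hol0_norm_le:
  assumes "disc_rep l u U" "\<And>z. z \<in> cball 0 (1 / 2 ^ l) \<Longrightarrow> cmod (U z) \<le> B"
  shows "hol0_norm l u \<le> B"
  unfolding hol0_norm_eq[OF assms(1)] using assms(2) by (intro cSUP_least) auto

lemma subspace_hol0_space: "subspace (hol0_space l)"
  unfolding subspace_def hol0_space_def
proof (intro conjI ballI allI CollectI; (elim CollectE exE)?)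
  have "disc_rep l 0 (\<lambda>_. 0)" by (auto simp: disc_rep_def germ_zero)
  then show "\<exists>U. disc_rep l 0 U" by blast
next
  fix u v U V assume UV: "disc_rep l u U" "disc_rep l v V"
  then have "u + v = germ (\<lambda>z. U z + V z)"
    using germ_add[of U V] disc_rep_analytic by (simp add: disc_rep_def)
  with UV have "disc_rep l (u + v) (\<lambda>z. U z + V z)"
    unfolding disc_rep_def by (auto intro!: holomorphic_intros continuous_intros)
  then show "\<exists>U. disc_rep l (u + v) U" by blast
next
  fix u U and r :: real assume U: "disc_rep l u U"
  then have "r *\<^sub>R u = germ (\<lambda>z. of_real r * U z)"
    using germ_scaleR[of U] disc_rep_analytic by (simp add: disc_rep_def)
  with U have "disc_rep l (r *\<^sub>R u) (\<lambda>z. of_real r * U z)"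
    unfolding disc_rep_def by (auto intro!: holomorphic_intros continuous_intros)
  then show "\<exists>U. disc_rep l (r *\<^sub>R u) U" by blast
qed

lemma incseq_hol0_space: "incseq hol0_space"
proof (rule incseq_SucI)
  fix l
  have "(1::real) / 2 ^ Suc l \<le> 1 / 2 ^ l" by (intro divide_left_mono) auto
  then have "ball 0 (1 / 2 ^ Suc l) \<subseteq> (ball 0 (1 / 2 ^ l) :: complex set)"
    "cball 0 (1 / 2 ^ Suc l) \<subseteq> (cball 0 (1 / 2 ^ l) :: complex set)" by auto
  then show "hol0_space l \<subseteq> hol0_space (Suc l)"
    unfolding hol0_space_def disc_rep_def
    by (blast intro: holomorphic_on_subset continuous_on_subset)
qed

text \<open>By the coefficient bound the terms are at most \<open>(2 ^ q * norm w) ^ n\<close> times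
  the norm of \<open>c\<close>. The chosen radius makes this ratio at most 1/2, and the constant 2
  is the geometric sum.\<close>

lemma weighted_l2_series:
  assumes "c \<in> weighted_l2 q" "norm w \<le> 1 / 2 ^ (q + 1)"
  shows "summable (\<lambda>n. c n * w ^ n)" and "norm (\<Sum>n. c n * w ^ n) \<le> 2 * weighted_norm q c"
proof -
  have le: "norm (c n * w ^ n) \<le> weighted_norm q c * (1 / 2) ^ n" for n
  proof -
    have "norm (c n) * norm w ^ n \<le> (weighted_norm q c * (2 ^ q) ^ n) * (1 / 2 ^ (q + 1)) ^ n"
      using assms weighted_norm_nonneg[OF assms(1)]
      by (intro mult_mono weighted_l2_coeff_bound power_mono) auto
    also have "\<dots> = weighted_norm q c * (2 ^ q * (1 / 2 ^ (q + 1))) ^ n"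
      by (simp only: power_mult_distrib mult.assoc)
    also have "(2::real) ^ q * (1 / 2 ^ (q + 1)) = 1 / 2" by simp
    finally show ?thesis by (simp add: norm_mult norm_power)
  qed
  have geom: "(\<lambda>n. weighted_norm q c * (1 / 2) ^ n) sums (weighted_norm q c * 2)"
    using geometric_sums[of "1 / 2 :: real"] by (intro sums_mult) simp
  show "summable (\<lambda>n. c n * w ^ n)"
    using le sums_summable[OF geom] by (rule summable_comparison_test'[where N = 0, rotated])
  show "norm (\<Sum>n. c n * w ^ n) \<le> 2 * weighted_norm q c"
    using norm_suminf_le[OF le sums_summable[OF geom]] sums_unique[OF geom] by simp
qed

lemma weighted_l2_series_holomorphic:
  assumes "c \<in> weighted_l2 q"
  shows "(\<lambda>w. \<Sum>n. c n * w ^ n) holomorphic_on ball 0 (1 / 2 ^ (q + 1))"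
  by (rule power_series_holomorphic[where a = c])
     (use weighted_l2_series(1)[OF assms] in \<open>auto intro!: summable_sums\<close>)

section \<open>Power series in the local coordinate \<open>exp z - 1\<close>\<close>

definition exp_series :: "(nat \<Rightarrow> complex) \<Rightarrow> complex \<Rightarrow> complex" where
  "exp_series c z = (\<Sum>n. c n * (exp z - 1) ^ n)"

lemma eventually_exp_minus_1_in_ball: "r > 0 \<Longrightarrow> \<forall>\<^sub>F z in nhds (0::complex). exp z - 1 \<in> ball 0 r"
  using order_tendstoD(2)[OF tendsto_norm[OF exp_minus_1_tendsto_0]] by simp

text \<open>The set \<open>S\<close> is left free: it will be an open neighbourhood of 0, to obtain
  a germ, and a closed disc, to obtain continuity up to the boundary.\<close>

lemma exp_series_holomorphic:
  assumes "c \<in> weighted_l2 q" "\<And>z. z \<in> S \<Longrightarrow> exp z - 1 \<in> ball 0 (1 / 2 ^ (q + 1))"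
  shows "exp_series c holomorphic_on S"
proof -
  have "(\<lambda>w. \<Sum>n. c n * w ^ n) \<circ> (\<lambda>z. exp z - 1) holomorphic_on S"
    using assms(2)
    by (intro holomorphic_on_compose_gen[OF _ weighted_l2_series_holomorphic[OF assms(1)]] holomorphic_intros) auto
  then show ?thesis by (simp add: exp_series_def[abs_def] o_def)
qed

lemma exp_series_analytic:
  assumes "c \<in> weighted_l2 q"
  shows "exp_series c analytic_on {0}"
proof -
  obtain S where "open S" "0 \<in> S" "\<And>z. z \<in> S \<Longrightarrow> exp z - 1 \<in> ball (0::complex) (1 / 2 ^ (q + 1))"
    using eventually_exp_minus_1_in_ball[of "1 / 2 ^ (q + 1)"] unfolding eventually_nhds by auto
  then show ?thesis using exp_series_holomorphic[OF assms] analytic_at by blast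
qed

lemma exp_series_sums:
  assumes "c \<in> weighted_l2 q"
  shows "\<forall>\<^sub>F z in nhds 0. (\<lambda>n. c n * (exp z - 1) ^ n) sums exp_series c z"
proof -
  have "\<forall>\<^sub>F z in nhds (0::complex). exp z - 1 \<in> ball 0 (1 / 2 ^ (q + 1))"
    by (intro eventually_exp_minus_1_in_ball) simp
  then show ?thesis
  proof eventually_elim
    case (elim z)
    then show ?case unfolding exp_series_def
      by (intro summable_sums weighted_l2_series(1)[OF assms]) auto
  qed
qed

lemma eventually_Ln_exp: "\<forall>\<^sub>F z in nhds 0. Ln (exp z) = z"
proof -
  have "\<forall>\<^sub>F z in nhds 0. z \<in> ball (0::complex) pi" by (intro eventually_nhds_in_open) auto
  then show ?thesis
  proof eventually_elim
    case (elim z)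
    then have "\<bar>Im z\<bar> < pi" using abs_Im_le_cmod[of z] by simp
    then show ?case by (intro Ln_exp) auto
  qed
qed

text \<open>Substituting \<open>z = Ln (1 + w)\<close> turns both functions into ordinary power
  series in \<open>w\<close>, whose coefficients are unique.\<close>

lemma germ_exp_series_inject:
  assumes "c \<in> weighted_l2 q" "d \<in> weighted_l2 p" "germ (exp_series c) = germ (exp_series d)"
  shows "c = d"
proof -
  have "\<forall>\<^sub>F z in nhds 0. exp_series c z = exp_series d z"
    using assms(3) germ_eq_iff[OF exp_series_analytic[OF assms(1)] exp_series_analytic[OF assms(2)]] by blast
  then have "\<forall>\<^sub>F w in nhds 0. exp_series c (Ln (1 + w)) = exp_series d (Ln (1 + w))"
    using Ln_add_1_tendsto_0 by (rule eventually_compose_filterlim)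
  moreover have "\<forall>\<^sub>F w in nhds 0. w \<in> ball (0::complex) 1" by (intro eventually_nhds_in_open) auto
  ultimately have eq: "\<forall>\<^sub>F w in nhds 0. (\<Sum>n. c n * w ^ n) = (\<Sum>n. d n * w ^ n)"
  proof eventually_elim
    case (elim w)
    then have "1 + w \<noteq> 0" by (metis add.commute add_eq_0_iff mem_ball_0 norm_minus_cancel norm_one order_less_irrefl)
    then show ?case using elim by (simp add: exp_series_def)
  qed
  have sums: "\<forall>\<^sub>F w in nhds 0. (\<lambda>n. w ^ n * a n) sums (\<Sum>n. a n * w ^ n)" if "a \<in> weighted_l2 k" for a k
  proof -
    have "\<forall>\<^sub>F w in nhds 0. w \<in> ball (0::complex) (1 / 2 ^ (k + 1))" by (intro eventually_nhds_in_open) auto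
    then show ?thesis
    proof eventually_elim
      case (elim w)
      then have "(\<lambda>n. a n * w ^ n) sums (\<Sum>n. a n * w ^ n)"
        by (intro summable_sums weighted_l2_series(1)[OF that]) auto
      then show ?case by (simp add: mult.commute)
    qed
  qed
  have "\<forall>\<^sub>F w in nhds 0. (\<lambda>n. w ^ n * d n) sums (\<Sum>n. c n * w ^ n)"
    using sums[OF assms(2)] eq by eventually_elim simp
  then have "Abs_fps d = Abs_fps c"
    using sums[OF assms(1)] by (intro fps_expansion_unique_complex has_fps_expansion_Abs_fpsI)
  then have "fps_nth (Abs_fps d) n = fps_nth (Abs_fps c) n" for n by simp
  then show "c = d" by (simp add: fun_eq_iff)
qed

text \<open>The factorial in \<open>pairing\<close> cancels the one in the Appell coefficient. The
  neighbourhood on which this holds depends on \<open>q\<close>, but the germ does not, so the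
  \<open>THE\<close> has a unique solution.\<close>

lemma S_transform_dual_series:
  assumes "lam > 0" "\<beta> > 0" "c \<in> weighted_l2 p"
  shows "S_transform lam \<beta> (dual_series lam \<beta> c) = germ (exp_series c)"
proof -
  let ?g = "\<lambda>q. germ (\<lambda>z. pairing lam \<beta> q (wick_exp lam \<beta> z) (dual_series lam \<beta> c))"
  have ev: "\<forall>\<^sub>F q in sequentially. germ (exp_series c) = ?g q"
    using appell_coeff_wick_exp[OF assms(2), of lam]
  proof eventually_elim
    case (elim q)
    then have "\<forall>\<^sub>F z in nhds 0. pairing lam \<beta> q (wick_exp lam \<beta> z) (dual_series lam \<beta> c) = exp_series c z"
    proof eventually_elim
      case (elim z)
      then show ?case
        by (simp add: pairing_def dual_coeff_dual_series assms exp_series_def mult.commute)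
    qed
    then show ?case using germ_eqI[OF exp_series_analytic[OF assms(3)]] by metis
  qed
  show ?thesis
    unfolding S_transform_def
  proof (rule the_equality, rule ev)
    fix u assume "\<forall>\<^sub>F q in sequentially. u = ?g q"
    then have "\<forall>\<^sub>F q::nat in sequentially. u = germ (exp_series c)" using ev by eventually_elim simp
    then show "u = germ (exp_series c)" by simp
  qed
qed

lemma exp_series_bounded:
  obtains l where "\<And>c. c \<in> weighted_l2 q \<Longrightarrow> germ (exp_series c) \<in> hol0_space l"
    "\<And>c. c \<in> weighted_l2 q \<Longrightarrow> hol0_norm l (germ (exp_series c)) \<le> 2 * weighted_norm q c"
proof -
  \<comment> \<open>The disc depends on \<open>q\<close> alone, so one \<open>l\<close> works for
    all \<open>c\<close>; the strict inequality places the image of the closed disc in the open ball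
    of holomorphy.\<close>
  obtain l where l: "\<And>z::complex. z \<in> cball 0 (1 / 2 ^ l) \<Longrightarrow> norm (exp z - 1) < 1 / 2 ^ (q + 1)"
    by (rule ex_pow_cball_less[OF exp_minus_1_tendsto_0, of "1 / 2 ^ (q + 1)"]) auto
  have rep: "disc_rep l (germ (exp_series c)) (exp_series c)" if "c \<in> weighted_l2 q" for c
  proof -
    have "exp_series c holomorphic_on cball 0 (1 / 2 ^ l)"
      using l by (intro exp_series_holomorphic[OF that]) auto
    then show ?thesis
      unfolding disc_rep_def
      by (auto intro: holomorphic_on_subset holomorphic_on_imp_continuous_on)
  qed
  have "cmod (exp_series c z) \<le> 2 * weighted_norm q c"
    if "c \<in> weighted_l2 q" "z \<in> cball 0 (1 / 2 ^ l)" for c z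
    unfolding exp_series_def using l[OF that(2)] by (intro weighted_l2_series(2)[OF that(1)]) auto
  then show thesis
    using that[of l] rep hol0_norm_le unfolding hol0_space_def by blast
qed

lemma exp_series_surj:
  obtains m where "\<And>u. u \<in> hol0_space l \<Longrightarrow>
    \<exists>c\<in>weighted_l2 (2 * m + 1). germ (exp_series c) = u \<and> weighted_norm (2 * m + 1) c \<le> 2 * hol0_norm l u"
proof -
  \<comment> \<open>Strictness matters: \<open>U\<close> is holomorphic inside its disc but merely
    continuous on the boundary.\<close>
  obtain m0 where m0: "\<And>w. w \<in> cball 0 (1 / 2 ^ m0) \<Longrightarrow> norm (Ln (1 + w)) < 1 / 2 ^ l"
    by (rule ex_pow_cball_less[OF Ln_add_1_tendsto_0, of "1 / 2 ^ l"]) auto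
  \<comment> \<open>The extra 1 makes the radius \<open>1 / 2 ^ m\<close> smaller than 1, so that
    \<open>1 + w\<close> avoids the branch cut even if \<open>m0 = 0\<close>.\<close>
  define m where "m = Suc m0"
  have "(1::real) / 2 ^ m \<le> 1 / 2 ^ m0" unfolding m_def by (intro divide_left_mono) auto
  then have m: "norm (Ln (1 + w)) < 1 / 2 ^ l" if "w \<in> cball 0 (1 / 2 ^ m)" for w
    using that by (intro m0) auto
  have not_neg: "1 + w \<notin> \<real>\<^sub>\<le>\<^sub>0" if "w \<in> cball 0 (1 / 2 ^ m)" for w :: complex
  proof -
    have "(1::real) / 2 ^ m < 1" using one_less_power[of "2::real" m] by (simp add: m_def)
    moreover have "cmod w \<le> 1 / 2 ^ m" using that by simp
    ultimately have "\<bar>Re w\<bar> < 1" using abs_Re_le_cmod[of w] by linarith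
    then show ?thesis by (auto simp: complex_nonpos_Reals_iff)
  qed
  have "\<exists>c\<in>weighted_l2 (2 * m + 1). germ (exp_series c) = u \<and> weighted_norm (2 * m + 1) c \<le> 2 * hol0_norm l u"
    if u: "u \<in> hol0_space l" for u
  proof -
    obtain U where U: "disc_rep l u U" using u unfolding hol0_space_def by blast
    define g where "g w = U (Ln (1 + w))" for w
    define c where "c n = (deriv ^^ n) g 0 / fact n" for n
    have "U \<circ> (\<lambda>w. Ln (1 + w)) holomorphic_on cball 0 (1 / 2 ^ m)"
      using U m not_neg unfolding disc_rep_def
      by (intro holomorphic_on_compose_gen[of _ _ U "ball 0 (1 / 2 ^ l)"] holomorphic_intros) auto
    then have g: "g holomorphic_on cball 0 (1 / 2 ^ m)" by (simp add: g_def[abs_def] o_def)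
    have "norm (g w) \<le> hol0_norm l u" if "w \<in> cball 0 (1 / 2 ^ m)" for w
      unfolding g_def using m[OF that] by (intro norm_le_hol0_norm[OF U]) auto
    then have "norm ((deriv ^^ n) g 0) \<le> fact n * hol0_norm l u / (1 / 2 ^ m) ^ n" for n
      using g by (intro Cauchy_inequality)
        (auto intro: holomorphic_on_subset holomorphic_on_imp_continuous_on)
    then have "norm (c n) \<le> hol0_norm l u * (2 ^ m) ^ n" for n
      by (simp add: c_def norm_divide power_one_over field_simps)
    note c = weighted_l2_geometric[of c, OF this]
    have "\<forall>\<^sub>F z in nhds (0::complex). exp z - 1 \<in> ball 0 (1 / 2 ^ m)"
      by (intro eventually_exp_minus_1_in_ball) simp
    \<comment> \<open>Near 0 the Taylor series of \<open>g\<close> at \<open>exp z - 1\<close> sums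
      to \<open>U (Ln (exp z)) = U z\<close>.\<close>
    with eventually_Ln_exp have "\<forall>\<^sub>F z in nhds 0. exp_series c z = U z"
    proof eventually_elim
      case (elim z)
      have "(\<lambda>n. c n * (exp z - 1 - 0) ^ n) sums g (exp z - 1)"
        unfolding c_def using elim(2) g by (intro holomorphic_power_series) (auto intro: holomorphic_on_subset)
      then have "exp_series c z = g (exp z - 1)" unfolding exp_series_def by (simp add: sums_iff)
      then show ?case using elim(1) by (simp add: g_def)
    qed
    then have "germ (exp_series c) = u"
      using germ_eqI[OF disc_rep_analytic[OF U]] U unfolding disc_rep_def by metis
    then show ?thesis using c by blast
  qed
  then show thesis using that by blast
qed

theorem theorem6p3:
  fixes lam \<beta> :: real
  assumes "lam > 0" and "0 < \<beta>" and "\<beta> \<le> 1"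
  shows "homeomorphic_map (gen_topology lam \<beta>) hol0_topology (S_transform lam \<beta>)"
  unfolding gen_topology_def hol0_topology_def
proof (rule homeomorphic_map_ind_lim_topology)
  let ?E = "\<Union>q. gen_space lam \<beta> q"
  note S = S_transform_dual_series[OF assms(1,2)]
  show E: "subspace ?E" by (intro subspace_Union_incseq subspace_gen_space incseq_gen_space)
  show "subspace (\<Union>l. hol0_space l)" by (intro subspace_Union_incseq subspace_hol0_space incseq_hol0_space)
  have cases: "\<exists>q. \<exists>c\<in>weighted_l2 q. x = dual_series lam \<beta> c" if "x \<in> ?E" for x
    using that unfolding gen_space_eq_image by blast
  \<comment> \<open>Both functions are moved to the larger of their orders, so that their
    coefficients can be added within one sequence space.\<close>
  have cases2: "\<exists>q c d. c \<in> weighted_l2 q \<and> d \<in> weighted_l2 q \<and> x = dual_series lam \<beta> c \<and> y = dual_series lam \<beta> d"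
    if xy: "x \<in> ?E" "y \<in> ?E" for x y
  proof -
    obtain p q where "x \<in> gen_space lam \<beta> p" "y \<in> gen_space lam \<beta> q" using xy by blast
    then have "x \<in> gen_space lam \<beta> (max p q)" "y \<in> gen_space lam \<beta> (max p q)"
      using incseqD[OF incseq_gen_space[of lam \<beta>], of p "max p q"] incseqD[OF incseq_gen_space[of lam \<beta>], of q "max p q"] by auto
    then show ?thesis unfolding gen_space_eq_image by blast
  qed
  show "S_transform lam \<beta> (x + y) = S_transform lam \<beta> x + S_transform lam \<beta> y" if xy: "x \<in> ?E" "y \<in> ?E" for x y
  proof -
    obtain q c d where cd: "c \<in> weighted_l2 q" "d \<in> weighted_l2 q"
      and eqs: "x = dual_series lam \<beta> c" "y = dual_series lam \<beta> d" using cases2[OF xy] by blast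
    \<comment> \<open>Termwise addition uses convergence of both series, so additivity is obtained
      near 0, which suffices for germs.\<close>
    have "\<forall>\<^sub>F z in nhds 0. exp_series c z + exp_series d z = exp_series (\<lambda>n. c n + d n) z"
      using exp_series_sums[OF cd(1)] exp_series_sums[OF cd(2)]
    proof eventually_elim
      case (elim z)
      then show ?case using sums_unique[OF sums_add[OF elim]] by (simp add: exp_series_def ring_distribs)
    qed
    then have "germ (\<lambda>z. exp_series c z + exp_series d z) = germ (exp_series (\<lambda>n. c n + d n))"
      by (intro germ_eqI exp_series_analytic[OF weighted_l2_add[OF cd]])
    then show ?thesis
      unfolding eqs dual_series_add[symmetric] S[OF cd(1)] S[OF cd(2)] S[OF weighted_l2_add[OF cd]]
      using cd exp_series_analytic germ_add by metis
  qed
  show "S_transform lam \<beta> (r *\<^sub>R x) = r *\<^sub>R S_transform lam \<beta> x" if x: "x \<in> ?E" for x r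
  proof -
    obtain q c where c: "c \<in> weighted_l2 q" and eq: "x = dual_series lam \<beta> c" using cases[OF x] by blast
    have "\<forall>\<^sub>F z in nhds 0. of_real r * exp_series c z = exp_series (\<lambda>n. r *\<^sub>R c n) z"
      using exp_series_sums[OF c]
    proof eventually_elim
      case (elim z)
      then show ?case
        using sums_unique[OF sums_mult[OF elim, of "of_real r"]]
        by (simp add: exp_series_def scaleR_conv_of_real mult.assoc)
    qed
    then have "germ (\<lambda>z. of_real r * exp_series c z) = germ (exp_series (\<lambda>n. r *\<^sub>R c n))"
      by (intro germ_eqI exp_series_analytic[OF weighted_l2_scaleR[OF c]])
    then show ?thesis
      unfolding eq dual_series_scaleR[symmetric] S[OF c] S[OF weighted_l2_scaleR[OF c]]
      using c exp_series_analytic germ_scaleR by metis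
  qed
  show "inj_on (S_transform lam \<beta>) ?E"
  proof (rule inj_onI)
    fix x y assume xy: "x \<in> ?E" "y \<in> ?E" and eq: "S_transform lam \<beta> x = S_transform lam \<beta> y"
    obtain q c d where cd: "c \<in> weighted_l2 q" "d \<in> weighted_l2 q"
      "x = dual_series lam \<beta> c" "y = dual_series lam \<beta> d" using cases2[OF xy] by blast
    then have "c = d" using eq germ_exp_series_inject[OF cd(1,2)] S by simp
    then show "x = y" using cd by simp
  qed
  show "\<exists>l K. K > 0 \<and> (\<forall>x\<in>gen_space lam \<beta> q. S_transform lam \<beta> x \<in> hol0_space l \<and>
      hol0_norm l (S_transform lam \<beta> x) \<le> K * gen_norm lam \<beta> q x)" for q
  proof -
    obtain l where l: "\<And>c. c \<in> weighted_l2 q \<Longrightarrow> germ (exp_series c) \<in> hol0_space l"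
      "\<And>c. c \<in> weighted_l2 q \<Longrightarrow> hol0_norm l (germ (exp_series c)) \<le> 2 * weighted_norm q c"
      by (rule exp_series_bounded) blast
    show ?thesis
      unfolding gen_space_eq_image
      by (intro exI[of _ l] exI[of _ 2]) (auto simp: S l gen_norm_dual_series assms)
  qed
  show "\<exists>q K. K > 0 \<and> (\<forall>u\<in>hol0_space l. \<exists>x\<in>gen_space lam \<beta> q. S_transform lam \<beta> x = u \<and>
      gen_norm lam \<beta> q x \<le> K * hol0_norm l u)" for l
  proof -
    obtain m where m: "\<And>u. u \<in> hol0_space l \<Longrightarrow>
      \<exists>c\<in>weighted_l2 (2 * m + 1). germ (exp_series c) = u \<and> weighted_norm (2 * m + 1) c \<le> 2 * hol0_norm l u"
      by (rule exp_series_surj) blast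
    have "\<exists>x\<in>gen_space lam \<beta> (2 * m + 1). S_transform lam \<beta> x = u \<and>
      gen_norm lam \<beta> (2 * m + 1) x \<le> 2 * hol0_norm l u" if u: "u \<in> hol0_space l" for u
    proof -
      obtain c where "c \<in> weighted_l2 (2 * m + 1)" "germ (exp_series c) = u"
        "weighted_norm (2 * m + 1) c \<le> 2 * hol0_norm l u" using m[OF u] by blast
      then show ?thesis
        unfolding gen_space_eq_image
        by (intro bexI[of _ "dual_series lam \<beta> c"]) (simp_all add: S gen_norm_dual_series assms)
    qed
    then show ?thesis by (intro exI[of _ "2 * m + 1"] exI[of _ 2]) auto
  qed
qed

end
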